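(* Let $b>\frac13$. There is a constant $C>0$, independent of $h$, such that for every $0<h\le1$ with $h=\pi/N$, $N\in\mathbb N$, each choice of sign $\pm$, and every $f_h\in X_{h,\pm}^{0,b}(\mathbb R\times\mathbb T_h)$, $$\|f_h\|_{L^4_t(\mathbb R:L^4(\mathbb T_h))}\le C\,\|f_h\|_{X_{h,\pm}^{0,b}(\mathbb R\times\mathbb T_h)}.$$
   Context: $\mathbb T_h=h\mathbb Z/2\pi\mathbb Z=\{hn:n=-N,\dots,N-1\}$ with $h=\pi/N$, $(\mathbb T_h)^*=\mathbb Z/2N\mathbb Z=\{-N,\dots,N-1\}$, $\|f_h\|_{L^p(\mathbb T_h)}=(h\sum_{x\in\mathbb T_h}|f_h(x)|^p)^{1/p}$. For $f_h$ on $\mathbb R\times\mathbb T_h$ the space-time Fourier transform is $\widetilde{f_h}(\tau,k)=\frac h{2\pi}\sum_{x\in\mathbb T_h}\int_{\mathbb R}e^{-it\tau}e^{-ixk}f_h(t,x)\,dt$. With $\langle a\rangle=(1+a^2)^{1/2}$ and $$s_h(k)=\frac1{h^2}\left(k-\frac2h\sin\left(\frac{hk}2\right)\right),\qquad k\in\{-N,\dots,N-1\},$$ the space $X_{h,\pm}^{s,b}(\mathbb R\times\mathbb T_h)$ is the completion of the functions that are Schwartz in $t$ with respect to $$\|f_h\|_{X_{h,\pm}^{s,b}}^2=\sum_{k\in(\mathbb T_h)^*}\int_{\mathbb R}\langle k\rangle^{2s}\langle\tau\mp s_h(k)\rangle^{2b}|\widetilde{f_h}(\tau,k)|^2\,d\tau.$$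 *)

theory Defs
  imports "HOL-Analysis.Analysis"
begin

text \<open>A function on the product of the real line and the grid is a map of type
  \<^typ>\<open>real \<Rightarrow> real \<Rightarrow> complex\<close> of which only the values at points \<open>x\<close> of \<open>torus_grid N\<close> matter. All
  notions are indexed by \<open>N\<close>, the mesh size being \<open>h = mesh N\<close>; for \<open>N = 0\<close> they are junk.\<close>

definition mesh :: "nat \<Rightarrow> real" where
  "mesh N = pi / real N"

definition torus_grid :: "nat \<Rightarrow> real set" where
  "torus_grid N = (\<lambda>n. mesh N * real_of_int n) ` {- int N..<int N}"

definition grid_freqs :: "nat \<Rightarrow> int set" where
  "grid_freqs N = {- int N..<int N}"

definition Lp_grid_norm :: "nat \<Rightarrow> real \<Rightarrow> (real \<Rightarrow> complex) \<Rightarrow> real" where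
  "Lp_grid_norm N p g = (mesh N * (\<Sum>x\<in>torus_grid N. cmod (g x) powr p)) powr (1 / p)"

definition LtLx_space :: "nat \<Rightarrow> real \<Rightarrow> real \<Rightarrow> (real \<Rightarrow> real \<Rightarrow> complex) set" where
  "LtLx_space N p q =
     {f. (\<forall>x\<in>torus_grid N. (\<lambda>t. f t x) \<in> borel_measurable lborel) \<and>
         integrable lborel (\<lambda>t. Lp_grid_norm N q (f t) powr p)}"

definition LtLx_norm :: "nat \<Rightarrow> real \<Rightarrow> real \<Rightarrow> (real \<Rightarrow> real \<Rightarrow> complex) \<Rightarrow> real" where
  "LtLx_norm N p q f = (LINT t|lborel. Lp_grid_norm N q (f t) powr p) powr (1 / p)"

definition schwartz :: "(real \<Rightarrow> complex) \<Rightarrow> bool" where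
  "schwartz g \<longleftrightarrow>
     (\<exists>D :: nat \<Rightarrow> real \<Rightarrow> complex. D 0 = g \<and>
        (\<forall>m t. (D m has_vector_derivative D (Suc m) t) (at t)) \<and>
        (\<forall>j m. \<exists>B. \<forall>t. \<bar>t\<bar> ^ j * cmod (D m t) \<le> B))"

definition schwartz_in_time :: "nat \<Rightarrow> (real \<Rightarrow> real \<Rightarrow> complex) \<Rightarrow> bool" where
  "schwartz_in_time N f \<longleftrightarrow> (\<forall>x\<in>torus_grid N. schwartz (\<lambda>t. f t x))"

definition st_fourier :: "nat \<Rightarrow> (real \<Rightarrow> real \<Rightarrow> complex) \<Rightarrow> real \<Rightarrow> int \<Rightarrow> complex" where
  "st_fourier N f \<tau> k =
     complex_of_real (mesh N / (2 * pi)) *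
     (\<Sum>x\<in>torus_grid N. LINT t|lborel.
        exp (- \<i> * complex_of_real (t * \<tau>)) * exp (- \<i> * complex_of_real (x * real_of_int k)) * f t x)"

definition bracket :: "real \<Rightarrow> real" where
  "bracket a = sqrt (1 + a\<^sup>2)"

definition dispersion :: "nat \<Rightarrow> int \<Rightarrow> real" where
  "dispersion N k =
     1 / (mesh N)\<^sup>2 * (real_of_int k - 2 / mesh N * sin (mesh N * real_of_int k / 2))"

text \<open>The sign is a real number \<open>\<sigma>\<close>, \<open>1\<close> for the upper and \<open>- 1\<close> for the lower choice, so that
  \<open>\<tau> - \<sigma> * dispersion N k\<close> is \<open>\<tau> \<mp> s\<^sub>h(k)\<close>. The following is the norm on functions that are
  Schwartz in time, for which the integrals converge.\<close>

definition X_pre_norm ::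
    "nat \<Rightarrow> real \<Rightarrow> real \<Rightarrow> real \<Rightarrow> (real \<Rightarrow> real \<Rightarrow> complex) \<Rightarrow> real" where
  "X_pre_norm N \<sigma> s b f =
     sqrt (\<Sum>k\<in>grid_freqs N. LINT \<tau>|lborel.
        bracket (real_of_int k) powr (2 * s) *
        bracket (\<tau> - \<sigma> * dispersion N k) powr (2 * b) * (cmod (st_fourier N f \<tau> k))\<^sup>2)"

text \<open>For \<open>b \<ge> 0\<close> and fixed \<open>N > 0\<close> the norm \<open>X_pre_norm\<close> dominates a multiple of the space-time
  \<open>L\<^sup>2\<close> norm, and by Plancherel and Fatou a Cauchy sequence for \<open>X_pre_norm\<close> tending to \<open>0\<close> in
  \<open>L\<^sup>2\<close> also tends to \<open>0\<close> in \<open>X_pre_norm\<close>. Hence the completion embeds into \<open>L\<^sup>2\<close>: its elements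
  are the \<open>L\<^sup>2\<close> limits of the \<open>X_pre_norm\<close>-Cauchy sequences, and are realised as such below, up to
  equality almost everywhere. The definitions are only meant for \<open>b \<ge> 0\<close>.\<close>

definition X_represents ::
    "nat \<Rightarrow> real \<Rightarrow> real \<Rightarrow> real \<Rightarrow> (nat \<Rightarrow> real \<Rightarrow> real \<Rightarrow> complex) \<Rightarrow> (real \<Rightarrow> real \<Rightarrow> complex) \<Rightarrow> bool" where
  "X_represents N \<sigma> s b \<phi> f \<longleftrightarrow>
     (\<forall>n. schwartz_in_time N (\<phi> n)) \<and>
     (\<forall>e>0. \<exists>M. \<forall>m\<ge>M. \<forall>n\<ge>M. X_pre_norm N \<sigma> s b (\<lambda>t x. \<phi> m t x - \<phi> n t x) < e) \<and>
     f \<in> LtLx_space N 2 2 \<and>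
     (\<lambda>n. LtLx_norm N 2 2 (\<lambda>t x. \<phi> n t x - f t x)) \<longlonglongrightarrow> 0"

definition X_space :: "nat \<Rightarrow> real \<Rightarrow> real \<Rightarrow> real \<Rightarrow> (real \<Rightarrow> real \<Rightarrow> complex) set" where
  "X_space N \<sigma> s b = {f. \<exists>\<phi>. X_represents N \<sigma> s b \<phi> f}"

text \<open>By the preceding remark the limit does not depend on the representing sequence, so exactly one
  \<open>r\<close> qualifies when \<open>f\<close> lies in \<open>X_space\<close>.\<close>

definition X_norm :: "nat \<Rightarrow> real \<Rightarrow> real \<Rightarrow> real \<Rightarrow> (real \<Rightarrow> real \<Rightarrow> complex) \<Rightarrow> real" where
  "X_norm N \<sigma> s b f =
     (SOME r. \<exists>\<phi>. X_represents N \<sigma> s b \<phi> f \<and> (\<lambda>n. X_pre_norm N \<sigma> s b (\<phi> n)) \<longlonglongrightarrow> r)"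

end

theory Submission
  imports Defs "HOL-Probability.Characteristic_Functions" "HOL-Probability.Sinc_Integral"
begin

text \<open>The argument is Bourgain's. Split \<open>f\<close> dyadically in the modulation
  \<open>\<langle>\<tau> - \<sigma> s\<^sub>h(k)\<rangle>\<close>; since \<open>b > 1/3\<close> it suffices to show
  \<open>\<parallel>u\<parallel>\<^sub>4 \<le> C M\<^bsup>1/3\<^esup> \<parallel>u\<parallel>\<^sub>2\<close> for a piece \<open>u\<close> of modulation at most \<open>M\<close>. By Plancherel this is a
  bound on the output frequencies \<open>l\<close> of \<open>u\<^sup>2\<close>. The at most \<open>3 M\<^bsup>1/3\<^esup>\<close> frequencies with
  \<open>\<bar>l\<bar> < M\<^bsup>1/3\<^esup>\<close> are estimated by H"older's and Bernstein's inequalities. For the other ones,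
  \<open>j \<mapsto> s\<^sub>h(j) + s\<^sub>h(l - j)\<close> equals a constant minus a multiple of \<open>sin (hl/4) cos (h(2j - l)/4)\<close>,
  so it varies at least like \<open>\<bar>l\<bar> \<bar>j - j'\<bar>\<^sup>2\<close> on each side of \<open>l/2\<close>, and a window of length
  \<open>O(M)\<close> contains \<open>O(M\<^bsup>1/3\<^esup>)\<close> values of it.\<close>

subsection \<open>Fourier integrals and the Plancherel inequality\<close>

text \<open>The exponent 1/3 is a balance. Output frequencies of size at least R admit O(sqrt(M/R))
  pairs in a window of length O(M), while there are O(R) frequencies below R; the two numbers agree
  for M = R^3. Both ranges then contribute R M = R^4 to the fourth power of the norm, that is
  M^(1/3) to the norm, and the weight M^b makes the dyadic sum geometric for b > 1/3.

  As h tends to 0, s_h(k) tends to k^3/24, and the count becomes that for j^3 + (l-j)^3, which is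
  quadratic in j with leading coefficient 3l. On the grid, uniformity in h hinges on three sine
  factors that together supply h^3 against the factor h^(-3) of the dispersion. Their arguments stay
  within pi/2 because the frequencies lie in [-N, N) and their sum l is kept as an integer in [-2N,
  2N) instead of a residue modulo 2N.

  The limits in the norm estimates (Gaussian regularisation, truncation, completion) are taken by
  Fatou's lemma, so upper bounds suffice and Plancherel enters as an inequality.\<close>

definition ift :: "(real \<Rightarrow> complex) \<Rightarrow> real \<Rightarrow> complex" where
  "ift G t = (LINT \<tau>|lborel. cis (t * \<tau>) * G \<tau>)"

lemma borel_measurable_cis [measurable (raw)]:
  "f \<in> borel_measurable M \<Longrightarrow> (\<lambda>x. cis (f x)) \<in> borel_measurable M"
  unfolding cis_conv_exp by measurable

lemma ift_borel_measurable:
  assumes [measurable]: "G \<in> borel_measurable borel"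
  shows "ift G \<in> borel_measurable borel"
proof -
  have "(\<lambda>t. LINT \<tau>|lborel. cis (t * \<tau>) * G \<tau>) \<in> borel_measurable borel"
    by (rule lborel.borel_measurable_lebesgue_integral) measurable
  then show ?thesis by (simp add: ift_def[abs_def])
qed

lemma integrable_cis_mult:
  fixes G :: "'a \<Rightarrow> complex"
  assumes "integrable M G" "f \<in> borel_measurable M"
  shows "integrable M (\<lambda>x. cis (f x) * G x)"
  by (rule Bochner_Integration.integrable_bound[OF integrable_norm[OF assms(1)]])
     (use assms in \<open>auto simp: norm_mult\<close>)

text \<open>A regulariser with explicit transform: it tends to 1 as \<open>e\<close> tends to 0, and
  its Fourier integral is \<open>2 * pi\<close> times the normal density of standard deviation
  \<open>e\<close>, an approximate identity. Plancherel and inversion both rest on it.\<close>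

definition gauss :: "real \<Rightarrow> real \<Rightarrow> real" where
  "gauss e t = exp (- (e * t)\<^sup>2 / 2)"

lemma gauss_eq_normal_density:
  "e > 0 \<Longrightarrow> gauss e t = sqrt (2 * pi) / e * normal_density 0 (1 / e) t"
  by (simp add: gauss_def normal_density_def power_divide power_mult_distrib real_sqrt_mult
      real_sqrt_divide field_simps)

lemma integrable_gauss: "e > 0 \<Longrightarrow> integrable lborel (gauss e)"
  by (subst ext[OF gauss_eq_normal_density]) auto

lemma borel_measurable_gauss [measurable]: "gauss e \<in> borel_measurable borel"
  unfolding gauss_def[abs_def] by measurable

lemma gauss_bounds: "0 < gauss e t" "gauss e t \<le> 1"
  by (auto simp: gauss_def)

text \<open>After the substitution \<open>t = x / e\<close> the integral becomes the characteristic
  function of the standard normal distribution at \<open>a / e\<close>.\<close>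

lemma fourier_gauss:
  assumes "e > 0"
  shows "(LINT t|lborel. cis (t * a) * gauss e t) = 2 * pi * normal_density 0 e a"
proof -
  have "(LINT t|lborel. cis (t * a) * gauss e t) =
      (LINT x|lborel. cis (a / e * x) * gauss 1 x) /\<^sub>R e"
    by (subst lborel_integral_real_affine[where c = "1 / e" and t = 0])
       (use assms in \<open>simp_all add: gauss_def scaleR_conv_of_real field_simps\<close>)
  also have "(LINT x|lborel. cis (a / e * x) * gauss 1 x) =
      (LINT x|lborel. sqrt (2 * pi) * (std_normal_density x *\<^sub>R cis (a / e * x)))"
    by (rule Bochner_Integration.integral_cong)
       (auto simp: gauss_def std_normal_density_def scaleR_conv_of_real real_sqrt_mult)
  also have "\<dots> = sqrt (2 * pi) * (LINT x|lborel. std_normal_density x *\<^sub>R cis (a / e * x))"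
    by (rule integral_mult_right_zero)
  also have "(LINT x|lborel. std_normal_density x *\<^sub>R cis (a / e * x)) =
      char std_normal_distribution (a / e)"
    unfolding char_def by (subst integral_density) (auto simp: cis_conv_exp)
  also have "\<dots> = exp (- (a / e)\<^sup>2 / 2)"
    by (simp add: char_std_normal_distribution)
  finally have "(LINT t|lborel. cis (t * a) * gauss e t) =
      complex_of_real (sqrt (2 * pi) * exp (- (a / e)\<^sup>2 / 2) / e)"
    using assms by (simp add: scaleR_conv_of_real field_simps)
  also have "sqrt (2 * pi) * exp (- (a / e)\<^sup>2 / 2) / e = 2 * pi * normal_density 0 e a"
    using assms real_sqrt_pow2[of "2 * pi"]
    by (simp add: normal_density_def real_sqrt_mult field_simps power2_eq_square)
  finally show ?thesis .
qed

lemma gauss_tendsto: "(\<lambda>n. gauss (1 / Suc n) t) \<longlonglongrightarrow> 1"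
proof -
  have "(\<lambda>n. exp (- ((1 / Suc n) * t)\<^sup>2 / 2)) \<longlonglongrightarrow> exp (- (0 * t)\<^sup>2 / 2)"
    by (intro tendsto_intros LIMSEQ_Suc[OF lim_1_over_n]) auto
  then show ?thesis by (simp add: gauss_def)
qed

lemma nn_integral_normal_density:
  "e > 0 \<Longrightarrow> (\<integral>\<^sup>+y. ennreal (normal_density 0 e (x - y)) \<partial>lborel) = 1"
  "e > 0 \<Longrightarrow> (\<integral>\<^sup>+y. ennreal (normal_density 0 e (y - x)) \<partial>lborel) = 1"
proof -
  assume e: "e > 0"
  have *: "(\<integral>\<^sup>+y. ennreal (normal_density 0 e y) \<partial>lborel) = 1"
    using e by (subst nn_integral_eq_integral) auto
  show "(\<integral>\<^sup>+y. ennreal (normal_density 0 e (x - y)) \<partial>lborel) = 1"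
    using * by (subst (asm) nn_integral_real_affine[where c = "-1" and t = x]) auto
  show "(\<integral>\<^sup>+y. ennreal (normal_density 0 e (y - x)) \<partial>lborel) = 1"
    using * by (subst (asm) nn_integral_real_affine[where c = "1" and t = "- x"]) auto
qed

lemma pair_sigma_finite_lborel_pair: "pair_sigma_finite lborel (lborel \<Otimes>\<^sub>M lborel :: (real \<times> real) measure)"
  by (simp add: lborel_prod pair_sigma_finite_def sigma_finite_lborel)

lemma integrable_pair_mult:
  fixes f g :: "real \<Rightarrow> complex"
  assumes f: "integrable lborel f" and g: "integrable lborel g"
  shows "integrable (lborel \<Otimes>\<^sub>M lborel) (\<lambda>(x, y). f x * g y)"
proof (rule lborel_pair.Fubini_integrable)
  show "(\<lambda>(x, y). f x * g y) \<in> borel_measurable (lborel \<Otimes>\<^sub>M lborel)"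
    using f g by measurable
  show "integrable lborel (\<lambda>x. LINT y|lborel. norm (case (x, y) of (x, y) \<Rightarrow> f x * g y))"
    using f by (simp add: norm_mult)
  show "AE x in lborel. integrable lborel (\<lambda>y. case (x, y) of (x, y) \<Rightarrow> f x * g y)"
    using g by simp
qed

text \<open>Expanding the square gives a double integral over two frequencies; integrating in
  \<open>t\<close> first turns the Gaussian into a kernel of mass \<open>2 * pi\<close> in each
  variable. Schur's test then bounds the quadratic form, with no loss in the constant as
  \<open>e\<close> varies.\<close>

lemma plancherel_gauss:
  assumes G: "integrable lborel G" and G2: "integrable lborel (\<lambda>\<tau>. (cmod (G \<tau>))\<^sup>2)"
    and e: "e > 0"
  shows "(\<integral>\<^sup>+t. ennreal ((cmod (ift G t))\<^sup>2 * gauss e t) \<partial>lborel) \<le>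
    ennreal (2 * pi * (LINT \<tau>|lborel. (cmod (G \<tau>))\<^sup>2))"
proof -
  have [measurable]: "G \<in> borel_measurable borel" using G by auto
  note ift_borel_measurable[measurable]
  interpret P: pair_sigma_finite lborel "lborel \<Otimes>\<^sub>M lborel :: (real \<times> real) measure"
    by (rule pair_sigma_finite_lborel_pair)
  define H where "H p = G (fst p) * cnj (G (snd p))" for p
  have H: "integrable (lborel \<Otimes>\<^sub>M lborel) H"
    using integrable_pair_mult[OF G, of "\<lambda>x. cnj (G x)"] G
    by (simp add: H_def[abs_def] case_prod_beta')
  then have [measurable]: "H \<in> borel_measurable (lborel \<Otimes>\<^sub>M lborel)" by auto
  have sq: "complex_of_real ((cmod (ift G t))\<^sup>2) =
      (LINT p|(lborel \<Otimes>\<^sub>M lborel). cis (t * (fst p - snd p)) * H p)" for t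
  proof -
    let ?g = "\<lambda>x. cis (t * x) * G x"
    have g: "integrable lborel ?g"
      by (rule integrable_cis_mult[OF G]) simp
    have "(LINT p|(lborel \<Otimes>\<^sub>M lborel). cis (t * (fst p - snd p)) * H p) =
        (LINT p|(lborel \<Otimes>\<^sub>M lborel). (\<lambda>(x, y). ?g x * cnj (?g y)) p)"
    proof (rule Bochner_Integration.integral_cong[OF refl])
      fix p :: "real \<times> real"
      have "cis (t * (fst p - snd p)) = cis (t * fst p) * cis (- (t * snd p))"
        by (simp add: cis_mult right_diff_distrib)
      then show "cis (t * (fst p - snd p)) * H p = (\<lambda>(x, y). ?g x * cnj (?g y)) p"
        by (simp add: H_def case_prod_beta cis_cnj)
    qed
    also have "\<dots> = (LINT x|lborel. LINT y|lborel. ?g x * cnj (?g y))"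
      by (rule lborel_pair.integral_fst[symmetric, OF integrable_pair_mult[OF g integrable_cnj[OF g]]])
    also have "\<dots> = ift G t * cnj (ift G t)"
      by (simp add: ift_def del: complex_cnj_mult)
    finally show ?thesis
      by (simp only: complex_norm_square)
  qed
  \<comment> \<open>The Gaussian is what makes Fubini applicable: the other factors have modulus
    independent of \<open>t\<close>.\<close>
  have int3: "integrable (lborel \<Otimes>\<^sub>M (lborel \<Otimes>\<^sub>M lborel))
      (\<lambda>(t, p). cis (t * (fst p - snd p)) * H p * gauss e t)"
  proof (rule P.Fubini_integrable)
    show "(\<lambda>(t, p). cis (t * (fst p - snd p)) * H p * gauss e t)
        \<in> borel_measurable (lborel \<Otimes>\<^sub>M (lborel \<Otimes>\<^sub>M lborel))"
      by measurable
    show "integrable lborel (\<lambda>t. LINT p|(lborel \<Otimes>\<^sub>M lborel).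
        norm (case (t, p) of (t, p) \<Rightarrow> cis (t * (fst p - snd p)) * H p * gauss e t))"
      using gauss_bounds(1)[of e] integrable_gauss[OF e]
      by (simp add: norm_mult less_imp_le)
    show "AE t in lborel. integrable (lborel \<Otimes>\<^sub>M lborel)
        (\<lambda>p. case (t, p) of (t, p) \<Rightarrow> cis (t * (fst p - snd p)) * H p * gauss e t)"
      using integrable_cis_mult[OF H] by simp
  qed
  have intsq: "integrable lborel (\<lambda>t. complex_of_real ((cmod (ift G t))\<^sup>2 * gauss e t))"
    using P.integrable_fst[OF int3] by (simp add: sq del: of_real_power)
  have inner: "(LINT t|lborel. cis (t * (fst p - snd p)) * H p * gauss e t) =
      H p * (2 * pi * normal_density 0 e (fst p - snd p))" for p
    unfolding fourier_gauss[OF e, symmetric]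
    by (subst integral_mult_right_zero[symmetric]) (simp add: mult_ac)
  have int2: "integrable (lborel \<Otimes>\<^sub>M lborel) (\<lambda>p. H p * (2 * pi * normal_density 0 e (fst p - snd p)))"
    using P.integrable_snd[OF int3] by (simp only: inner)
  have "complex_of_real (LINT t|lborel. (cmod (ift G t))\<^sup>2 * gauss e t) =
      (LINT t|lborel. LINT p|(lborel \<Otimes>\<^sub>M lborel). cis (t * (fst p - snd p)) * H p * gauss e t)"
    by (simp add: sq del: of_real_power flip: integral_complex_of_real)
  also have "\<dots> = (LINT p|(lborel \<Otimes>\<^sub>M lborel). LINT t|lborel. cis (t * (fst p - snd p)) * H p * gauss e t)"
    by (rule P.Fubini_integral[OF int3, symmetric])
  also have "\<dots> = (LINT p|(lborel \<Otimes>\<^sub>M lborel). H p * (2 * pi * normal_density 0 e (fst p - snd p)))"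
    by (simp only: inner)
  finally have eq: "complex_of_real (LINT t|lborel. (cmod (ift G t))\<^sup>2 * gauss e t) = \<dots>" .
  let ?g = "\<lambda>x y. ennreal ((cmod (G x))\<^sup>2) * ennreal (normal_density 0 e (x - y))"
  have "(\<integral>\<^sup>+t. ennreal ((cmod (ift G t))\<^sup>2 * gauss e t) \<partial>lborel) =
      ennreal (LINT t|lborel. (cmod (ift G t))\<^sup>2 * gauss e t)"
    using complex_of_real_integrable_eq[THEN iffD1, OF intsq] gauss_bounds(1)[of e]
    by (subst nn_integral_eq_integral) (auto simp: less_imp_le)
  also have "\<dots> \<le> ennreal (cmod (LINT p|(lborel \<Otimes>\<^sub>M lborel).
      H p * (2 * pi * normal_density 0 e (fst p - snd p))))"
    unfolding eq[symmetric] by (simp add: ennreal_leI)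
  \<comment> \<open>The mixed product of \<open>G\<close> at two points is split into squares, so
    each term involves \<open>G\<close> at one point only and the kernel can be integrated over the
    other.\<close>
  also have "\<dots> \<le> (\<integral>\<^sup>+p. ennreal (norm (H p * (2 * pi * normal_density 0 e (fst p - snd p)))) \<partial>(lborel \<Otimes>\<^sub>M lborel))"
    by (rule integral_norm_bound_ennreal[OF int2])
  also have "\<dots> \<le> (\<integral>\<^sup>+p. ennreal pi * (?g (fst p) (snd p) + 
      ennreal ((cmod (G (snd p)))\<^sup>2) * ennreal (normal_density 0 e (fst p - snd p))) \<partial>(lborel \<Otimes>\<^sub>M lborel))"
  proof (rule nn_integral_mono)
    fix p :: "real \<times> real"
    let ?a = "cmod (G (fst p))" and ?b = "cmod (G (snd p))" and ?n = "normal_density 0 e (fst p - snd p)"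
    have "2 * ?a * ?b \<le> ?a\<^sup>2 + ?b\<^sup>2" by (rule sum_squares_bound)
    then have "pi * ?n * (2 * ?a * ?b) \<le> pi * ?n * (?a\<^sup>2 + ?b\<^sup>2)"
      by (intro mult_left_mono) auto
    then show "ennreal (norm (H p * (2 * pi * ?n))) \<le> ennreal pi * (?g (fst p) (snd p) + ennreal (?b\<^sup>2) * ennreal ?n)"
      by (simp add: H_def norm_mult algebra_simps flip: ennreal_mult ennreal_plus)
  qed
  also have "\<dots> = ennreal pi * ((\<integral>\<^sup>+x. \<integral>\<^sup>+y. ?g x y \<partial>lborel \<partial>lborel) +
      (\<integral>\<^sup>+y. \<integral>\<^sup>+x. ennreal ((cmod (G y))\<^sup>2) * ennreal (normal_density 0 e (x - y)) \<partial>lborel \<partial>lborel))"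
    by (subst nn_integral_cmult, measurable, subst nn_integral_add, measurable)
       (simp add: lborel.nn_integral_fst[symmetric] case_prod_beta'
          lborel_pair.Fubini'[of "\<lambda>x y. ennreal ((cmod (G y))\<^sup>2) * ennreal (normal_density 0 e (x - y))"])
  also have "\<dots> = ennreal pi * ((\<integral>\<^sup>+x. ennreal ((cmod (G x))\<^sup>2) \<partial>lborel) + (\<integral>\<^sup>+x. ennreal ((cmod (G x))\<^sup>2) \<partial>lborel))"
    by (simp add: nn_integral_cmult nn_integral_normal_density[OF e])
  also have "\<dots> = ennreal (2 * pi * (LINT \<tau>|lborel. (cmod (G \<tau>))\<^sup>2))"
    by (simp add: nn_integral_eq_integral[OF G2] integral_nonneg_AE algebra_simps flip: ennreal_mult ennreal_plus)
  finally show ?thesis .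
qed

text \<open>Fatou along \<open>e = 1 / Suc n\<close>: the regularised bound does not depend on
  \<open>e\<close>.\<close>

lemma plancherel_le:
  assumes G: "integrable lborel G" and G2: "integrable lborel (\<lambda>\<tau>. (cmod (G \<tau>))\<^sup>2)"
  shows "(\<integral>\<^sup>+t. ennreal ((cmod (ift G t))\<^sup>2) \<partial>lborel) \<le>
    ennreal (2 * pi * (LINT \<tau>|lborel. (cmod (G \<tau>))\<^sup>2))"
proof -
  have [measurable]: "G \<in> borel_measurable borel" using G by auto
  note ift_borel_measurable[measurable]
  have lim: "(\<lambda>n. ennreal ((cmod (ift G t))\<^sup>2 * gauss (1 / Suc n) t)) \<longlonglongrightarrow> ennreal ((cmod (ift G t))\<^sup>2)" for t
  proof -
    have "(\<lambda>n. (cmod (ift G t))\<^sup>2 * gauss (1 / Suc n) t) \<longlonglongrightarrow> (cmod (ift G t))\<^sup>2 * 1"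
      by (intro tendsto_mult tendsto_const gauss_tendsto)
    then show ?thesis by simp
  qed
  have "(\<integral>\<^sup>+t. ennreal ((cmod (ift G t))\<^sup>2) \<partial>lborel) =
      (\<integral>\<^sup>+t. liminf (\<lambda>n. ennreal ((cmod (ift G t))\<^sup>2 * gauss (1 / Suc n) t)) \<partial>lborel)"
    using lim_imp_Liminf[OF _ lim] by simp
  also have "\<dots> \<le> liminf (\<lambda>n. \<integral>\<^sup>+t. ennreal ((cmod (ift G t))\<^sup>2 * gauss (1 / Suc n) t) \<partial>lborel)"
    by (rule nn_integral_liminf) measurable
  also have "\<dots> \<le> ennreal (2 * pi * (LINT \<tau>|lborel. (cmod (G \<tau>))\<^sup>2))"
    by (rule order_trans[OF Liminf_mono[where g = "\<lambda>_. ennreal (2 * pi * (LINT \<tau>|lborel. (cmod (G \<tau>))\<^sup>2))"]])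
       (use plancherel_gauss[OF G G2] in \<open>auto simp: Liminf_const\<close>)
  finally show ?thesis .
qed

subsection \<open>Band-limited functions\<close>

definition energy :: "(real \<Rightarrow> complex) \<Rightarrow> real" where
  "energy G = (LINT \<tau>|lborel. (cmod (G \<tau>))\<^sup>2)"

text \<open>\<open>G\<close> lives on the frequency side; in the application \<open>c\<close> is a
  value of the dispersion relation and \<open>M\<close> bounds the modulation. Boundedness is
  qualitative: it yields integrability of \<open>G\<close>, its square and the convolution
  integrands, and its constant enters no estimate.\<close>

definition band :: "real \<Rightarrow> real \<Rightarrow> (real \<Rightarrow> complex) \<Rightarrow> bool" where
  "band c M G \<longleftrightarrow> G \<in> borel_measurable borel \<and> (\<exists>B. \<forall>\<tau>. cmod (G \<tau>) \<le> B) \<and>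
     (\<forall>\<tau>. M < \<bar>\<tau> - c\<bar> \<longrightarrow> G \<tau> = 0)"

lemma energy_nonneg [simp]: "0 \<le> energy G"
  by (simp add: energy_def)

lemma band_measurable: "band c M G \<Longrightarrow> G \<in> borel_measurable borel"
  by (simp add: band_def)

lemma integrable_compact_bounded:
  fixes f :: "real \<Rightarrow> 'a::{banach, second_countable_topology}"
  assumes "f \<in> borel_measurable borel" "\<And>\<tau>. norm (f \<tau>) \<le> B" "\<And>\<tau>. M < \<bar>\<tau> - c\<bar> \<Longrightarrow> f \<tau> = 0"
  shows "integrable lborel f"
proof (rule Bochner_Integration.integrable_bound)
  show "integrable lborel (\<lambda>\<tau>. indicator {c - M..c + M} \<tau> *\<^sub>R B)"
    by (intro integrable_scaleR_left integrable_real_indicator)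
       (auto simp: emeasure_lborel_Icc_eq)
  have "norm (f \<tau>) \<le> norm (indicator {c - M..c + M} \<tau> *\<^sub>R B)" for \<tau>
    using assms(2)[of \<tau>] assms(3)[of \<tau>] by (cases "M < \<bar>\<tau> - c\<bar>") (auto simp: indicator_def)
  then show "AE \<tau> in lborel. norm (f \<tau>) \<le> norm (indicator {c - M..c + M} \<tau> *\<^sub>R B)"
    by simp
qed (use assms(1) in simp)

lemma band_integrable: "band c M G \<Longrightarrow> integrable lborel G"
  unfolding band_def by (metis integrable_compact_bounded)

lemma band_square_integrable:
  assumes "band c M G" shows "integrable lborel (\<lambda>\<tau>. (cmod (G \<tau>))\<^sup>2)"
proof -
  from assms obtain B where B: "\<And>\<tau>. cmod (G \<tau>) \<le> B" and [measurable]: "G \<in> borel_measurable borel"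
    by (auto simp: band_def)
  show ?thesis
    by (rule integrable_compact_bounded[where B = "B\<^sup>2" and M = M and c = c])
       (use assms B in \<open>auto simp: band_def intro: power_mono\<close>)
qed

lemma nn_integral_energy:
  "band c M G \<Longrightarrow> (\<integral>\<^sup>+\<tau>. ennreal ((cmod (G \<tau>))\<^sup>2) \<partial>lborel) = ennreal (energy G)"
  unfolding energy_def by (rule nn_integral_eq_integral[OF band_square_integrable]) auto

text \<open>Cauchy-Schwarz against the indicator of an interval of length \<open>2 * M\<close>
  containing the support. The form with \<open>ennreal\<close> values applies before any
  integrability is established.\<close>

lemma nn_integral_square_le:
  fixes u :: "real \<Rightarrow> ennreal"
  assumes [measurable]: "u \<in> borel_measurable borel" and M: "M \<ge> 0"
    and supp: "\<And>s. M < \<bar>s - c\<bar> \<Longrightarrow> u s = 0"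
  shows "(\<integral>\<^sup>+s. u s \<partial>lborel)\<^sup>2 \<le> ennreal (2 * M) * (\<integral>\<^sup>+s. (u s)\<^sup>2 \<partial>lborel)"
proof -
  have "u s * indicator {c - M..c + M} s = u s" for s
    using supp[of s] by (cases "M < \<bar>s - c\<bar>") (auto simp: indicator_def)
  then have "(\<integral>\<^sup>+s. u s \<partial>lborel)\<^sup>2 = (\<integral>\<^sup>+s. u s * indicator {c - M..c + M} s \<partial>lborel)\<^sup>2"
    by simp
  also have "\<dots> \<le> (\<integral>\<^sup>+s. (u s)\<^sup>2 \<partial>lborel) * (\<integral>\<^sup>+s. (indicator {c - M..c + M} s)\<^sup>2 \<partial>lborel)"
    by (rule Cauchy_Schwarz_nn_integral) auto
  also have "(\<integral>\<^sup>+s. (indicator {c - M..c + M} s :: ennreal)\<^sup>2 \<partial>lborel) = (\<integral>\<^sup>+s. indicator {c - M..c + M} s \<partial>lborel)"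
    by (intro nn_integral_cong) (auto simp: indicator_def)
  also have "\<dots> = ennreal (2 * M)"
    using M by simp
  finally show ?thesis by (simp add: mult.commute)
qed

lemma cmod_integral_le:
  "integrable M f \<Longrightarrow> ennreal (cmod (integral\<^sup>L M f)) \<le> (\<integral>\<^sup>+x. ennreal (cmod (f x)) \<partial>M)"
  using integral_norm_bound_ennreal[of M f] by simp

text \<open>Bernstein's inequality in time: the supremum costs the square root of the
  bandwidth.\<close>

lemma ift_bound:
  assumes G: "band c M G" and M: "M \<ge> 0"
  shows "(cmod (ift G t))\<^sup>2 \<le> 2 * M * energy G"
proof -
  have [measurable]: "G \<in> borel_measurable borel" using G by (rule band_measurable)
  have "ennreal (cmod (ift G t)) \<le> (\<integral>\<^sup>+\<tau>. ennreal (cmod (cis (t * \<tau>) * G \<tau>)) \<partial>lborel)"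
    unfolding ift_def by (intro cmod_integral_le integrable_cis_mult band_integrable[OF G]) auto
  also have "\<dots> = (\<integral>\<^sup>+\<tau>. ennreal (cmod (G \<tau>)) \<partial>lborel)"
    by (simp add: norm_mult)
  finally have "(ennreal (cmod (ift G t)))\<^sup>2 \<le> (\<integral>\<^sup>+\<tau>. ennreal (cmod (G \<tau>)) \<partial>lborel)\<^sup>2"
    by (intro power_mono) auto
  also have "\<dots> \<le> ennreal (2 * M) * (\<integral>\<^sup>+s. (ennreal (cmod (G s)))\<^sup>2 \<partial>lborel)"
    by (rule nn_integral_square_le[where c = c]) (use G M in \<open>auto simp: band_def\<close>)
  also have "\<dots> = ennreal (2 * M * energy G)"
    using M by (simp add: ennreal_power nn_integral_energy[OF G] ennreal_mult)
  finally show ?thesis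
    using M by (simp add: ennreal_power)
qed

lemma plancherel_band:
  "band c M G \<Longrightarrow> (\<integral>\<^sup>+t. ennreal ((cmod (ift G t))\<^sup>2) \<partial>lborel) \<le> ennreal (2 * pi * energy G)"
  unfolding energy_def by (rule plancherel_le[OF band_integrable band_square_integrable])

section \<open>Convolutions of bands and the bilinear estimate\<close>

definition conv :: "(real \<Rightarrow> complex) \<Rightarrow> (real \<Rightarrow> complex) \<Rightarrow> real \<Rightarrow> complex" where
  "conv A B \<tau> = (LINT s|lborel. A s * B (\<tau> - s))"

lemma band_mult_integrable:
  assumes A: "band a M A" and B: "band b M' B"
  shows "integrable lborel (\<lambda>s. A s * B (\<tau> - s))"
proof -
  have [measurable]: "A \<in> borel_measurable borel" "B \<in> borel_measurable borel"
    using A B by (auto simp: band_def)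
  obtain K where K: "\<And>\<tau>. cmod (A \<tau>) \<le> K" using A by (auto simp: band_def)
  obtain L where L: "\<And>\<tau>. cmod (B \<tau>) \<le> L" using B by (auto simp: band_def)
  have K0: "0 \<le> K"
    using K[of 0] norm_ge_zero order_trans by blast
  show ?thesis
  proof (rule integrable_compact_bounded)
    show "(\<lambda>s. A s * B (\<tau> - s)) \<in> borel_measurable borel" by measurable
    show "cmod (A s * B (\<tau> - s)) \<le> K * L" for s
      unfolding norm_mult by (rule mult_mono[OF K L K0 norm_ge_zero])
    show "A s * B (\<tau> - s) = 0" if "M < \<bar>s - a\<bar>" for s
      using A that by (simp add: band_def)
  qed
qed

lemma conv_measurable:
  assumes [measurable]: "A \<in> borel_measurable borel" "B \<in> borel_measurable borel"
  shows "conv A B \<in> borel_measurable borel"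
proof -
  have "(\<lambda>\<tau>. LINT s|lborel. A s * B (\<tau> - s)) \<in> borel_measurable borel"
    by (rule lborel.borel_measurable_lebesgue_integral) measurable
  then show ?thesis by (simp add: conv_def[abs_def])
qed

lemma band_conv:
  assumes A: "band a M A" and B: "band b M' B"
  shows "band (a + b) (M + M') (conv A B)"
  unfolding band_def
proof (intro conjI allI impI)
  have [measurable]: "A \<in> borel_measurable borel" "B \<in> borel_measurable borel"
    using A B by (auto simp: band_def)
  then show "conv A B \<in> borel_measurable borel"
    by (rule conv_measurable)
  obtain L where L: "\<And>\<tau>. cmod (B \<tau>) \<le> L" using B by (auto simp: band_def)
  have "cmod (conv A B \<tau>) \<le> (LINT s|lborel. cmod (A s) * L)" for \<tau>
    unfolding conv_def
    by (rule Bochner_Integration.integral_norm_bound_integral[OF band_mult_integrable[OF A B]])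
       (use band_integrable[OF A] L in \<open>auto simp: norm_mult intro: mult_left_mono\<close>)
  then show "\<exists>K. \<forall>\<tau>. cmod (conv A B \<tau>) \<le> K" by blast
  show "conv A B \<tau> = 0" if "M + M' < \<bar>\<tau> - (a + b)\<bar>" for \<tau>
  proof -
    have z: "A s * B (\<tau> - s) = 0" for s
    proof -
      have "M < \<bar>s - a\<bar> \<or> M' < \<bar>\<tau> - s - b\<bar>" using that by linarith
      then show ?thesis using A B by (auto simp: band_def)
    qed
    show ?thesis unfolding conv_def z by simp
  qed
qed

text \<open>At each \<tau>, Cauchy-Schwarz over the support of \<open>A\<close> costs its length
  \<open>2 * M\<close>; the remaining squares separate by Tonelli and translation
  invariance.\<close>

lemma energy_conv:
  assumes A: "band a M A" and B: "band b M' B" and M: "M \<ge> 0"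
  shows "energy (conv A B) \<le> 2 * M * energy A * energy B"
proof -
  have [measurable]: "A \<in> borel_measurable borel" "B \<in> borel_measurable borel"
    using A B by (auto simp: band_def)
  note conv_measurable[measurable]
  let ?f = "\<lambda>s \<tau>. ennreal ((cmod (A s))\<^sup>2) * ennreal ((cmod (B (\<tau> - s)))\<^sup>2)"
  have "ennreal (energy (conv A B)) = (\<integral>\<^sup>+\<tau>. ennreal ((cmod (conv A B \<tau>))\<^sup>2) \<partial>lborel)"
    by (rule nn_integral_energy[OF band_conv[OF A B], symmetric])
  also have "\<dots> \<le> (\<integral>\<^sup>+\<tau>. ennreal (2 * M) * (\<integral>\<^sup>+s. ?f s \<tau> \<partial>lborel) \<partial>lborel)"
  proof (rule nn_integral_mono)
    fix \<tau> :: real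
    have "ennreal (cmod (conv A B \<tau>)) \<le> (\<integral>\<^sup>+s. ennreal (cmod (A s * B (\<tau> - s))) \<partial>lborel)"
      unfolding conv_def by (intro cmod_integral_le band_mult_integrable[OF A B])
    then have "(ennreal (cmod (conv A B \<tau>)))\<^sup>2 \<le> (\<integral>\<^sup>+s. ennreal (cmod (A s * B (\<tau> - s))) \<partial>lborel)\<^sup>2"
      by (intro power_mono) auto
    also have "\<dots> \<le> ennreal (2 * M) * (\<integral>\<^sup>+s. (ennreal (cmod (A s * B (\<tau> - s))))\<^sup>2 \<partial>lborel)"
      by (rule nn_integral_square_le[where c = a]) (use A M in \<open>auto simp: band_def\<close>)
    also have "\<dots> = ennreal (2 * M) * (\<integral>\<^sup>+s. ?f s \<tau> \<partial>lborel)"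
      by (simp add: norm_mult power_mult_distrib ennreal_power flip: ennreal_mult)
    finally show "ennreal ((cmod (conv A B \<tau>))\<^sup>2) \<le> ennreal (2 * M) * (\<integral>\<^sup>+s. ?f s \<tau> \<partial>lborel)"
      by (simp add: ennreal_power)
  qed
  also have "\<dots> = ennreal (2 * M) * (\<integral>\<^sup>+\<tau>. \<integral>\<^sup>+s. ?f s \<tau> \<partial>lborel \<partial>lborel)"
    by (rule nn_integral_cmult) measurable
  also have "(\<integral>\<^sup>+\<tau>. \<integral>\<^sup>+s. ?f s \<tau> \<partial>lborel \<partial>lborel) = (\<integral>\<^sup>+s. \<integral>\<^sup>+\<tau>. ?f s \<tau> \<partial>lborel \<partial>lborel)"
    by (rule lborel_pair.Fubini') measurable
  also have "\<dots> = (\<integral>\<^sup>+s. ennreal ((cmod (A s))\<^sup>2) * ennreal (energy B) \<partial>lborel)"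
  proof (rule nn_integral_cong)
    fix s :: real
    have "(\<integral>\<^sup>+\<tau>. ennreal ((cmod (B (\<tau> - s)))\<^sup>2) \<partial>lborel) = ennreal (energy B)"
      unfolding nn_integral_energy[OF B, symmetric]
      by (subst (2) nn_integral_real_affine[where c = 1 and t = "- s"]) auto
    then show "(\<integral>\<^sup>+\<tau>. ?f s \<tau> \<partial>lborel) = ennreal ((cmod (A s))\<^sup>2) * ennreal (energy B)"
      by (simp add: nn_integral_cmult)
  qed
  also have "\<dots> = ennreal (energy A) * ennreal (energy B)"
    by (simp add: nn_integral_multc nn_integral_energy[OF A])
  also have "ennreal (2 * M) * (ennreal (energy A) * ennreal (energy B)) = ennreal (2 * M * energy A * energy B)"
    using M by (simp add: ennreal_mult mult.assoc)
  finally show ?thesis using M by simp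
qed

lemma ift_conv:
  assumes A: "band a M A" and B: "band b M' B"
  shows "ift (conv A B) t = ift A t * ift B t"
proof -
  have [measurable]: "A \<in> borel_measurable borel" "B \<in> borel_measurable borel"
    using A B by (auto simp: band_def)
  let ?f = "\<lambda>s \<tau>. cis (t * \<tau>) * (A s * B (\<tau> - s))"
  have shiftB: "integrable lborel (\<lambda>\<tau>. B (\<tau> - s))" for s
    using lborel_integrable_real_affine[OF band_integrable[OF B], of 1 "- s"] by simp
  have shiftN: "(LINT \<tau>|lborel. cmod (B (\<tau> - s))) = (LINT \<tau>|lborel. cmod (B \<tau>))" for s
    by (subst (2) lborel_integral_real_affine[where c = 1 and t = "- s"]) auto
  have int: "integrable (lborel \<Otimes>\<^sub>M lborel) (\<lambda>(s, \<tau>). ?f s \<tau>)"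
  proof (rule lborel_pair.Fubini_integrable)
    show "(\<lambda>(s, \<tau>). ?f s \<tau>) \<in> borel_measurable (lborel \<Otimes>\<^sub>M lborel)"
      by measurable
    show "integrable lborel (\<lambda>s. LINT \<tau>|lborel. norm (case (s, \<tau>) of (s, \<tau>) \<Rightarrow> ?f s \<tau>))"
      using band_integrable[OF A] by (simp add: norm_mult shiftN)
    show "AE s in lborel. integrable lborel (\<lambda>\<tau>. case (s, \<tau>) of (s, \<tau>) \<Rightarrow> ?f s \<tau>)"
      using shiftB by (auto intro!: integrable_cis_mult)
  qed
  have "ift (conv A B) t = (LINT \<tau>|lborel. LINT s|lborel. ?f s \<tau>)"
    unfolding ift_def conv_def by (subst integral_mult_right_zero) simp
  also have "\<dots> = (LINT s|lborel. LINT \<tau>|lborel. ?f s \<tau>)"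
    by (rule lborel_pair.Fubini_integral[OF int])
  also have "\<dots> = (LINT s|lborel. cis (t * s) * A s * ift B t)"
  proof (rule Bochner_Integration.integral_cong[OF refl])
    fix s :: real
    have "(LINT \<tau>|lborel. ?f s \<tau>) = (LINT \<tau>|lborel. ?f s (s + 1 * \<tau>))"
      by (subst lborel_integral_real_affine[where c = 1 and t = s]) auto
    also have "\<dots> = (LINT \<tau>|lborel. cis (t * s) * A s * (cis (t * \<tau>) * B \<tau>))"
      by (simp add: distrib_left mult_ac flip: cis_mult)
    also have "\<dots> = cis (t * s) * A s * ift B t"
      unfolding ift_def by (rule integral_mult_right_zero)
    finally show "(LINT \<tau>|lborel. ?f s \<tau>) = cis (t * s) * A s * ift B t" .
  qed
  also have "\<dots> = ift A t * ift B t"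
    by (simp add: ift_def)
  finally show ?thesis .
qed

lemma ift_sum:
  assumes "\<And>j. j \<in> S \<Longrightarrow> integrable lborel (H j)"
  shows "ift (\<lambda>\<tau>. \<Sum>j\<in>S. H j \<tau>) t = (\<Sum>j\<in>S. ift (H j) t)"
  unfolding ift_def sum_distrib_left
  by (rule Bochner_Integration.integral_sum) (rule integrable_cis_mult[OF assms], simp_all)

text \<open>Cauchy-Schwarz over the nonzero terms only. Through this inequality a count of
  overlapping supports becomes a norm bound.\<close>

lemma norm_sum_square_le:
  fixes f :: "'a \<Rightarrow> 'b::real_normed_vector"
  assumes "finite S" shows "(norm (sum f S))\<^sup>2 \<le> real (card {j\<in>S. f j \<noteq> 0}) * (\<Sum>j\<in>S. (norm (f j))\<^sup>2)"
proof -
  let ?T = "{j\<in>S. f j \<noteq> 0}"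
  have "sum f S = sum f ?T"
    using assms by (intro sum.mono_neutral_right) auto
  then have "(norm (sum f S))\<^sup>2 \<le> (\<Sum>j\<in>?T. norm (f j))\<^sup>2"
    by (simp add: power_mono norm_sum)
  also have "\<dots> \<le> real (card ?T) * (\<Sum>j\<in>?T. (norm (f j))\<^sup>2)"
    using Cauchy_Schwarz_ineq_sum[of "\<lambda>_. 1" "\<lambda>j. norm (f j)" ?T] by simp
  also have "\<dots> \<le> real (card ?T) * (\<Sum>j\<in>S. (norm (f j))\<^sup>2)"
    using assms by (intro mult_left_mono sum_mono2) auto
  finally show ?thesis .
qed

text \<open>On the frequency side the sum of products is a sum of convolutions, of which at most
  \<open>n\<close> are nonzero at any \<tau>, since the band radii add up to \<open>2 * M\<close>.
  The constant collects \<open>2 * pi\<close> from Plancherel, \<open>n\<close> from the overlap and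
  \<open>2 * M\<close> from \<open>energy_conv\<close>.\<close>

lemma bilinear_bound:
  assumes fin: "finite S" and M: "M \<ge> 0"
    and A: "\<And>j. j \<in> S \<Longrightarrow> band (a j) M (A j)" and B: "\<And>j. j \<in> S \<Longrightarrow> band (b j) M (B j)"
    and count: "\<And>\<tau>. real (card {j\<in>S. \<bar>\<tau> - (a j + b j)\<bar> \<le> 2 * M}) \<le> n"
  shows "(\<integral>\<^sup>+t. ennreal ((cmod (\<Sum>j\<in>S. ift (A j) t * ift (B j) t))\<^sup>2) \<partial>lborel) \<le>
    ennreal (4 * pi * n * M * (\<Sum>j\<in>S. energy (A j) * energy (B j)))"
proof -
  have bd: "band (a j + b j) (2 * M) (conv (A j) (B j))" if "j \<in> S" for j
    using band_conv[OF A[OF that] B[OF that]] by simp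
  note int = band_integrable[OF bd] and sqi = band_square_integrable[OF bd]
  have n: "0 \<le> n" using count[of 0] by (rule order_trans[rotated]) simp
  define H where "H \<tau> = (\<Sum>j\<in>S. conv (A j) (B j) \<tau>)" for \<tau>
  have H: "integrable lborel H"
    unfolding H_def[abs_def] using int by (rule Bochner_Integration.integrable_sum)
  have pt: "(cmod (H \<tau>))\<^sup>2 \<le> n * (\<Sum>j\<in>S. (cmod (conv (A j) (B j) \<tau>))\<^sup>2)" for \<tau>
  proof -
    have "{j\<in>S. conv (A j) (B j) \<tau> \<noteq> 0} \<subseteq> {j\<in>S. \<bar>\<tau> - (a j + b j)\<bar> \<le> 2 * M}"
      using bd unfolding band_def by (force intro: ccontr)
    then have "real (card {j\<in>S. conv (A j) (B j) \<tau> \<noteq> 0}) \<le> n"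
      using fin by (intro order_trans[OF _ count[of \<tau>]] of_nat_mono card_mono) auto
    then show ?thesis
      unfolding H_def
      by (intro order_trans[OF norm_sum_square_le[OF fin]] mult_right_mono sum_nonneg) auto
  qed
  have intR: "integrable lborel (\<lambda>\<tau>. n * (\<Sum>j\<in>S. (cmod (conv (A j) (B j) \<tau>))\<^sup>2))"
    using sqi by (intro integrable_mult_right Bochner_Integration.integrable_sum) auto
  have H2: "integrable lborel (\<lambda>\<tau>. (cmod (H \<tau>))\<^sup>2)"
    by (rule Bochner_Integration.integrable_bound[OF intR])
       (use H pt in \<open>auto intro!: AE_I2 order_trans[OF pt]\<close>)
  have "(\<Sum>j\<in>S. ift (A j) t * ift (B j) t) = ift H t" for t
    unfolding H_def[abs_def] by (subst ift_sum[OF int]) (auto intro!: sum.cong ift_conv[symmetric] A B)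
  then have "(\<integral>\<^sup>+t. ennreal ((cmod (\<Sum>j\<in>S. ift (A j) t * ift (B j) t))\<^sup>2) \<partial>lborel) \<le>
      ennreal (2 * pi * (LINT \<tau>|lborel. (cmod (H \<tau>))\<^sup>2))"
    using plancherel_le[OF H H2] by simp
  also have "\<dots> \<le> ennreal (2 * pi * (n * (\<Sum>j\<in>S. energy (conv (A j) (B j)))))"
  proof -
    have "(LINT \<tau>|lborel. (cmod (H \<tau>))\<^sup>2) \<le> (LINT \<tau>|lborel. n * (\<Sum>j\<in>S. (cmod (conv (A j) (B j) \<tau>))\<^sup>2))"
      by (rule integral_mono[OF H2 intR pt])
    also have "\<dots> = n * (\<Sum>j\<in>S. energy (conv (A j) (B j)))"
      unfolding energy_def using sqi by (simp add: Bochner_Integration.integral_sum)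
    finally show ?thesis by (intro ennreal_leI mult_left_mono) auto
  qed
  also have "\<dots> \<le> ennreal (2 * pi * (n * (\<Sum>j\<in>S. 2 * M * energy (A j) * energy (B j))))"
    using n M A B by (intro ennreal_leI mult_left_mono sum_mono energy_conv) auto
  also have "2 * pi * (n * (\<Sum>j\<in>S. 2 * M * energy (A j) * energy (B j))) =
      4 * pi * n * M * (\<Sum>j\<in>S. energy (A j) * energy (B j))"
    by (simp add: sum_distrib_left mult_ac)
  finally show ?thesis .
qed

subsection \<open>Separation of the dispersion relation\<close>

text \<open>With y = |x|/2, the double angle formula and tan y \<ge> y give sin |x| \<ge> 2 y cos^2
  y, and cos |x| \<ge> 0 means 2 cos^2 y \<ge> 1. This is a weak form of Jordan's
  inequality.\<close>

lemma abs_sin_ge_half: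
  fixes x :: real
  assumes "\<bar>x\<bar> \<le> pi / 2"
  shows "\<bar>x\<bar> / 2 \<le> \<bar>sin x\<bar>"
proof -
  define y where "y = \<bar>x\<bar> / 2"
  have y: "0 \<le> y" "y \<le> pi / 4" using assms by (auto simp: y_def)
  have cy: "0 < cos y" using y pi_gt_zero by (intro cos_gt_zero_pi) linarith+
  have sy: "0 \<le> sin y" using y pi_gt_zero by (intro sin_ge_zero) linarith+
  have "y \<le> tan y" using abs_tan_ge[of y] y sy cy pi_gt_zero by (simp add: tan_def)
  then have 1: "y * cos y \<le> sin y" using cy by (simp add: tan_def field_simps)
  have "0 \<le> cos (2 * y)" using assms by (intro cos_ge_zero) (auto simp: y_def)
  then have 2: "1 \<le> 2 * (cos y)\<^sup>2" by (simp add: cos_double_cos)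
  have "y \<le> y * (2 * (cos y)\<^sup>2)" using y 2 by (simp add: mult_le_cancel_left1)
  also have "\<dots> = 2 * (y * cos y) * cos y" by (simp add: power2_eq_square)
  also have "\<dots> \<le> 2 * sin y * cos y" using 1 cy by (intro mult_right_mono) auto
  also have "\<dots> = sin \<bar>x\<bar>" by (simp add: sin_double[symmetric] y_def)
  also have "\<dots> \<le> \<bar>sin x\<bar>" by (simp add: abs_if)
  finally show ?thesis by (simp add: y_def)
qed

lemma mesh_mult: "N > 0 \<Longrightarrow> mesh N * real N = pi"
  by (simp add: mesh_def)

lemma mesh_pos: "N > 0 \<Longrightarrow> 0 < mesh N"
  by (simp add: mesh_def)

text \<open>Sum-to-product: once \<open>j + k\<close> is fixed only the cosine depends on the pair,
  so comparing two pairs amounts to comparing two cosines.\<close>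

lemma dispersion_pair_sum:
  assumes "N > 0"
  shows "dispersion N j + dispersion N k =
    2 / mesh N ^ 3 * (mesh N * real_of_int (j + k) / 2 -
      2 * sin (mesh N * real_of_int (j + k) / 4) * cos (mesh N * real_of_int (j - k) / 4))"
proof -
  let ?h = "mesh N"
  have h: "?h > 0" using assms by (rule mesh_pos)
  have "sin (?h * j / 2) + sin (?h * k / 2) =
      2 * sin (?h * real_of_int (j + k) / 4) * cos (?h * real_of_int (j - k) / 4)"
    by (subst sin_plus_sin) (simp add: algebra_simps add_divide_distrib diff_divide_distrib)
  moreover have "dispersion N j + dispersion N k =
      2 / ?h ^ 3 * (?h * real_of_int (j + k) / 2 - (sin (?h * j / 2) + sin (?h * k / 2)))"
    using h unfolding dispersion_def by (simp add: field_simps power2_eq_square power3_eq_cube)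
  ultimately show ?thesis by simp
qed

text \<open>The difference of two cosines is a product of two sines; with the sine of hl/4 there are
  three sine factors, each bounded below linearly. Exchanging \<open>j\<close> and \<open>k\<close>
  preserves the sum of dispersions, so separation can hold only on one side of l/2, and
  \<open>ord\<close> selects that side.\<close>

lemma dispersion_pair_separation:
  assumes N: "N > 0" and K: "j \<in> grid_freqs N" "k \<in> grid_freqs N" "j' \<in> grid_freqs N" "k' \<in> grid_freqs N"
    and sum: "j + k = l" "j' + k' = l" and ord: "k \<le> j" "k' \<le> j'"
  shows "\<bar>real_of_int l\<bar> * (real_of_int (j - j'))\<^sup>2 \<le>
    64 * \<bar>(dispersion N j + dispersion N k) - (dispersion N j' + dispersion N k')\<bar>"
proof -
  let ?h = "mesh N"
  define a b b' where "a = ?h * real_of_int l / 4" and "b = ?h * real_of_int (j - k) / 4"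
    and "b' = ?h * real_of_int (j' - k') / 4"
  have h: "?h > 0" using N by (rule mesh_pos)
  \<comment> \<open>Sums and differences of two grid frequencies have modulus at most 2N, and h * 2N
    / 4 = pi/2 is exactly the range of \<open>abs_sin_ge_half\<close>.\<close>
  have bound: "?h * real_of_int m / 4 \<le> pi / 2" if "m \<le> 2 * int N" for m
  proof -
    have "?h * real_of_int m \<le> ?h * (2 * real N)"
      using h that by (intro mult_left_mono) auto
    then show ?thesis using mesh_mult[OF N] by (simp add: mult.left_commute)
  qed
  have a: "\<bar>a\<bar> \<le> pi / 2"
    using bound[of l] bound[of "- l"] K sum by (auto simp: a_def abs_le_iff grid_freqs_def)
  have b: "0 \<le> b" "b \<le> pi / 2" "0 \<le> b'" "b' \<le> pi / 2"
    using bound[of "j - k"] bound[of "j' - k'"] K ord h by (auto simp: b_def b'_def grid_freqs_def)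
  have kl: "k = l - j" "k' = l - j'" using sum by auto
  have bb: "b - b' = ?h * real_of_int (j - j') / 2"
    unfolding b_def b'_def kl by (simp add: field_simps)
  \<comment> \<open>Since \<open>b\<close> and \<open>b'\<close> are both nonnegative, their sum
    dominates the modulus of their difference.\<close>
  have sin_ab: "\<bar>b - b'\<bar> / 4 \<le> \<bar>sin ((b' + b) / 2)\<bar>"
    using abs_sin_ge_half[of "(b' + b) / 2"] b by auto
  have sin_d: "\<bar>b - b'\<bar> / 4 \<le> \<bar>sin ((b - b') / 2)\<bar>"
    using abs_sin_ge_half[of "(b - b') / 2"] b by auto
  have sin_a: "?h * \<bar>real_of_int l\<bar> / 8 \<le> \<bar>sin a\<bar>"
    using abs_sin_ge_half[OF a] h by (simp add: a_def abs_mult)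
  have "(dispersion N j + dispersion N k) - (dispersion N j' + dispersion N k') =
      4 / ?h ^ 3 * (sin a * (cos b' - cos b))"
    using sum by (simp add: dispersion_pair_sum[OF N] a_def b_def b'_def algebra_simps)
  also have "cos b' - cos b = 2 * sin ((b' + b) / 2) * sin ((b - b') / 2)"
    by (rule cos_diff_cos)
  finally have "\<bar>(dispersion N j + dispersion N k) - (dispersion N j' + dispersion N k')\<bar> =
      8 / ?h ^ 3 * (\<bar>sin a\<bar> * (\<bar>sin ((b' + b) / 2)\<bar> * \<bar>sin ((b - b') / 2)\<bar>))"
    using h by (simp add: abs_mult)
  \<comment> \<open>The lower bound for \<open>sin a\<close> carries one factor h and the squared
    difference of \<open>b\<close> and \<open>b'\<close> carries two, which cancels
    \<open>?h ^ 3\<close>. The 64 is 16 times the 4 coming from b - b' = h(j - j')/2.\<close>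
  also have "\<dots> \<ge> 8 / ?h ^ 3 * (?h * \<bar>real_of_int l\<bar> / 8 * (\<bar>b - b'\<bar> / 4 * (\<bar>b - b'\<bar> / 4)))"
    using h sin_a sin_ab sin_d by (intro mult_left_mono mult_mono) auto
  also have "8 / ?h ^ 3 * (?h * \<bar>real_of_int l\<bar> / 8 * (\<bar>b - b'\<bar> / 4 * (\<bar>b - b'\<bar> / 4))) =
      \<bar>real_of_int l\<bar> * (b - b')\<^sup>2 / (16 * ?h\<^sup>2)"
    using h by (simp add: field_simps power2_eq_square power3_eq_cube)
  also have "\<dots> = \<bar>real_of_int l\<bar> * (real_of_int (j - j'))\<^sup>2 / 64"
    using h unfolding bb by (simp add: field_simps power2_eq_square)
  finally show ?thesis by simp
qed

section \<open>Counting frequency pairs in a window\<close>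

lemma card_le_diameter:
  fixes A :: "int set"
  assumes fin: "finite A" and D: "D \<ge> 0" and diam: "\<And>i j. i \<in> A \<Longrightarrow> j \<in> A \<Longrightarrow> real_of_int \<bar>i - j\<bar> \<le> D"
  shows "real (card A) \<le> D + 1"
proof (cases "A = {}")
  case False
  have "A \<subseteq> {Min A..Max A}" using fin by auto
  then have "card A \<le> card {Min A..Max A}" by (rule card_mono[rotated]) simp
  then have "real (card A) \<le> real_of_int \<bar>Max A - Min A\<bar> + 1" by simp
  with diam[of "Max A" "Min A"] False fin show ?thesis by simp
qed (use D in simp)

definition freq_pairs :: "nat \<Rightarrow> int \<Rightarrow> int set" where
  "freq_pairs N l = {j \<in> grid_freqs N. l - j \<in> grid_freqs N}"

lemma finite_grid_freqs [simp]: "finite (grid_freqs N)"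
  by (simp add: grid_freqs_def)

lemma finite_freq_pairs [simp]: "finite (freq_pairs N l)"
  by (simp add: freq_pairs_def)

text \<open>Two members of the window have dispersion sums within \<open>4 * R ^ 3\<close>, so
  separation gives |l| (j - j')^2 \<le> 256 R^3, and |l| \<ge> R leaves |j - j'| \<le> 16R. The two
  sides of l/2 together give at most 2(16R + 1) \<le> 34R indices.\<close>

lemma freq_pairs_count:
  assumes N: "N > 0" and \<sigma>: "\<sigma> \<in> {1, - 1}" and R: "1 \<le> R" "R \<le> \<bar>real_of_int l\<bar>"
  shows "real (card {j \<in> freq_pairs N l. \<bar>\<tau> - (\<sigma> * dispersion N j + \<sigma> * dispersion N (l - j))\<bar> \<le> 2 * R ^ 3})
    \<le> 34 * R"
proof -
  define d where "d j = dispersion N j + dispersion N (l - j)" for j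
  define A where "A = {j \<in> freq_pairs N l. \<bar>\<tau> - \<sigma> * d j\<bar> \<le> 2 * R ^ 3}"
  define U where "U = {j \<in> A. l - j \<le> j}"
  define V where "V = {j \<in> A. j \<le> l - j}"
  have finA: "finite A" by (simp add: A_def)
  have dd: "\<bar>d j - d j'\<bar> \<le> 4 * R ^ 3" if "j \<in> A" "j' \<in> A" for j j'
  proof -
    have "\<bar>\<sigma> * d j - \<sigma> * d j'\<bar> \<le> 4 * R ^ 3" using that by (auto simp: A_def abs_le_iff)
    then show ?thesis using \<sigma> by auto
  qed
  have close: "real_of_int \<bar>j - j'\<bar> \<le> 16 * R"
    if "\<bar>real_of_int l\<bar> * (real_of_int (j - j'))\<^sup>2 \<le> 64 * \<bar>e\<bar>" "\<bar>e\<bar> \<le> 4 * R ^ 3" for j j' e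
  proof -
    have "R * (real_of_int (j - j'))\<^sup>2 \<le> \<bar>real_of_int l\<bar> * (real_of_int (j - j'))\<^sup>2"
      using R by (intro mult_right_mono) auto
    also have "\<dots> \<le> R * (16 * R)\<^sup>2"
      using that by (simp add: power2_eq_square power3_eq_cube)
    finally have "(real_of_int (j - j'))\<^sup>2 \<le> (16 * R)\<^sup>2" using R by simp
    then show ?thesis using R abs_le_square_iff[of "real_of_int (j - j')" "16 * R"] by simp
  qed
  have "real (card U) \<le> 16 * R + 1"
  proof (rule card_le_diameter)
    fix j j' assume "j \<in> U" "j' \<in> U"
    then show "real_of_int \<bar>j - j'\<bar> \<le> 16 * R"
      using dispersion_pair_separation[OF N, of j "l - j" j' "l - j'" l] dd[of j j']
      by (intro close[where e = "d j - d j'"]) (auto simp: U_def A_def freq_pairs_def d_def)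
  qed (use R finA in \<open>auto simp: U_def\<close>)
  \<comment> \<open>On \<open>V\<close> the larger member of the pair is \<open>l - j\<close>, so
    the separation lemma is applied with the two members exchanged; the square of
    \<open>j - j'\<close> is unaffected.\<close>
  moreover have "real (card V) \<le> 16 * R + 1"
  proof (rule card_le_diameter)
    fix j j' assume "j \<in> V" "j' \<in> V"
    then show "real_of_int \<bar>j - j'\<bar> \<le> 16 * R"
      using dispersion_pair_separation[OF N, of "l - j" j "l - j'" j' l] dd[of j j']
      by (intro close[where e = "d j - d j'"])
         (auto simp: V_def A_def freq_pairs_def d_def add.commute power2_commute)
  qed (use R finA in \<open>auto simp: V_def\<close>)
  moreover have "card A \<le> card U + card V"
    using card_Un_le[of U V] by (rule order_trans[OF card_mono, rotated 2]) (use finA in \<open>auto simp: U_def V_def\<close>)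
  ultimately have "real (card A) \<le> 34 * R" using R by linarith
  then show ?thesis by (simp add: A_def d_def distrib_left)
qed

text \<open>Sums of two grid frequencies stop at 2N - 2. The additional index 2N - 1, whose set of
  pairs is empty, makes the range two full periods of length 2N.\<close>

definition sum_freqs :: "nat \<Rightarrow> int set" where
  "sum_freqs N = {- 2 * int N..<2 * int N}"

text \<open>Each ordered pair of frequencies occurs once, under its own sum. Products of pair
  energies thereby add up to at most the square of the total energy.\<close>

lemma sum_freq_pairs_le:
  fixes e :: "int \<Rightarrow> real"
  assumes "\<And>k. 0 \<le> e k"
  shows "(\<Sum>l\<in>sum_freqs N. \<Sum>j\<in>freq_pairs N l. e j * e (l - j)) \<le> (\<Sum>k\<in>grid_freqs N. e k)\<^sup>2"
proof -
  let ?K = "grid_freqs N"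
  have "(\<Sum>l\<in>sum_freqs N. \<Sum>j\<in>freq_pairs N l. e j * e (l - j)) =
      (\<Sum>j\<in>?K. e j * (\<Sum>l\<in>{l \<in> sum_freqs N. l - j \<in> ?K}. e (l - j)))"
    unfolding freq_pairs_def sum_distrib_left
    by (rule sum.swap_restrict) (auto simp: sum_freqs_def)
  also have "\<dots> \<le> (\<Sum>j\<in>?K. e j * (\<Sum>k\<in>?K. e k))"
  proof (intro sum_mono mult_left_mono assms)
    fix j
    have "(\<Sum>l\<in>{l \<in> sum_freqs N. l - j \<in> ?K}. e (l - j)) =
        (\<Sum>k\<in>(\<lambda>l. l - j) ` {l \<in> sum_freqs N. l - j \<in> ?K}. e k)"
      by (subst sum.reindex) (auto simp: inj_on_def)
    also have "\<dots> \<le> (\<Sum>k\<in>?K. e k)"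
      using assms by (intro sum_mono2) auto
    finally show "(\<Sum>l\<in>{l \<in> sum_freqs N. l - j \<in> ?K}. e (l - j)) \<le> (\<Sum>k\<in>?K. e k)" .
  qed
  also have "\<dots> = (\<Sum>k\<in>?K. e k)\<^sup>2"
    by (simp add: power2_eq_square sum_distrib_right)
  finally show ?thesis .
qed

text \<open>Meant for the small output frequencies, where separation gives nothing: the bound is
  uniform in \<open>l\<close> because \<open>j\<close> and \<open>l - j\<close> each run injectively
  through grid frequencies.\<close>

lemma freq_pairs_cauchy_schwarz:
  fixes g :: "int \<Rightarrow> complex"
  shows "(cmod (\<Sum>j\<in>freq_pairs N l. g j * g (l - j)))\<^sup>2 \<le> (\<Sum>k\<in>grid_freqs N. (cmod (g k))\<^sup>2)\<^sup>2"
proof -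
  let ?P = "freq_pairs N l"
  have "(cmod (\<Sum>j\<in>?P. g j * g (l - j)))\<^sup>2 \<le> (\<Sum>j\<in>?P. cmod (g j) * cmod (g (l - j)))\<^sup>2"
    using norm_sum[of "\<lambda>j. g j * g (l - j)" ?P] by (intro power_mono) (auto simp: norm_mult)
  also have "\<dots> \<le> (\<Sum>j\<in>?P. (cmod (g j))\<^sup>2) * (\<Sum>j\<in>?P. (cmod (g (l - j)))\<^sup>2)"
    by (rule Cauchy_Schwarz_ineq_sum)
  also have "(\<Sum>j\<in>?P. (cmod (g (l - j)))\<^sup>2) = (\<Sum>k\<in>(\<lambda>j. l - j) ` ?P. (cmod (g k))\<^sup>2)"
    by (subst sum.reindex) (auto simp: inj_on_def)
  also have "(\<Sum>j\<in>?P. (cmod (g j))\<^sup>2) * \<dots> \<le> (\<Sum>k\<in>grid_freqs N. (cmod (g k))\<^sup>2) * (\<Sum>k\<in>grid_freqs N. (cmod (g k))\<^sup>2)"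
    by (intro mult_mono sum_mono2 sum_nonneg) (auto simp: freq_pairs_def)
  finally show ?thesis by (simp add: power2_eq_square)
qed

text \<open>The radius of the bands is written as \<open>M = R\<^sup>3\<close>, so that \<open>R\<close> is the threshold between small and
  large output frequencies.\<close>

lemma block_bound:
  fixes F :: "int \<Rightarrow> real \<Rightarrow> complex"
  assumes N: "N > 0" and \<sigma>: "\<sigma> \<in> {1, - 1}" and R: "1 \<le> R"
    and F: "\<And>k. k \<in> grid_freqs N \<Longrightarrow> band (\<sigma> * dispersion N k) (R ^ 3) (F k)"
  shows "(\<Sum>l\<in>sum_freqs N. \<integral>\<^sup>+t. ennreal ((cmod (\<Sum>j\<in>freq_pairs N l. ift (F j) t * ift (F (l - j)) t))\<^sup>2) \<partial>lborel)
    \<le> ennreal (148 * pi * R ^ 4 * (\<Sum>k\<in>grid_freqs N. energy (F k))\<^sup>2)"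
proof -
  let ?K = "grid_freqs N"
  define E where "E = (\<Sum>k\<in>?K. energy (F k))"
  define T where "T l = (\<Sum>j\<in>freq_pairs N l. energy (F j) * energy (F (l - j)))" for l
  define I where "I l = (\<integral>\<^sup>+t. ennreal ((cmod (\<Sum>j\<in>freq_pairs N l. ift (F j) t * ift (F (l - j)) t))\<^sup>2) \<partial>lborel)" for l
  define Z where "Z = {l \<in> sum_freqs N. \<bar>real_of_int l\<bar> < R}"
  have E0: "0 \<le> E" by (simp add: E_def sum_nonneg)
  have T0: "0 \<le> T l" for l by (simp add: T_def sum_nonneg)
  have [measurable]: "ift (F k) \<in> borel_measurable borel" if "k \<in> ?K" for k
    using F[OF that] by (intro ift_borel_measurable) (auto simp: band_def)
  \<comment> \<open>Overlap \<open>34 * R\<close> and band radius \<open>R ^ 3\<close> combine in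
    \<open>bilinear_bound\<close> to the order \<open>R ^ 4\<close>.\<close>
  have large: "I l \<le> ennreal (136 * pi * R ^ 4 * T l)" if "R \<le> \<bar>real_of_int l\<bar>" for l
  proof -
    have "I l \<le> ennreal (4 * pi * (34 * R) * R ^ 3 * T l)"
      unfolding I_def T_def
      by (rule bilinear_bound[where a = "\<lambda>j. \<sigma> * dispersion N j" and b = "\<lambda>j. \<sigma> * dispersion N (l - j)"])
         (use R F freq_pairs_count[OF N \<sigma> R that] in \<open>auto simp: freq_pairs_def\<close>)
    also have "4 * pi * (34 * R) * R ^ 3 * T l = 136 * pi * R ^ 4 * T l"
      by (simp add: power_numeral_reduce)
    finally show ?thesis .
  qed
  have small: "I l \<le> ennreal (4 * pi * R ^ 3 * E\<^sup>2)" for l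
  proof -
    have "(cmod (\<Sum>j\<in>freq_pairs N l. ift (F j) t * ift (F (l - j)) t))\<^sup>2 \<le>
        2 * R ^ 3 * E * (\<Sum>k\<in>?K. (cmod (ift (F k) t))\<^sup>2)" for t
    proof -
      have "(\<Sum>k\<in>?K. (cmod (ift (F k) t))\<^sup>2) \<le> (\<Sum>k\<in>?K. 2 * R ^ 3 * energy (F k))"
        using R F by (intro sum_mono ift_bound) auto
      also have "\<dots> = 2 * R ^ 3 * E" by (simp add: E_def sum_distrib_left)
      \<comment> \<open>One factor of the square is replaced by its Bernstein bound; the other is
        kept, to be integrated in \<open>t\<close> by Plancherel.\<close>
      finally have "(\<Sum>k\<in>?K. (cmod (ift (F k) t))\<^sup>2)\<^sup>2 \<le> 2 * R ^ 3 * E * (\<Sum>k\<in>?K. (cmod (ift (F k) t))\<^sup>2)"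
        unfolding power2_eq_square by (intro mult_right_mono sum_nonneg) auto
      then show ?thesis using freq_pairs_cauchy_schwarz[where g = "\<lambda>k. ift (F k) t" and N = N and l = l] by linarith
    qed
    then have "I l \<le> (\<integral>\<^sup>+t. ennreal (2 * R ^ 3 * E) * (\<Sum>k\<in>?K. ennreal ((cmod (ift (F k) t))\<^sup>2)) \<partial>lborel)"
      unfolding I_def using R E0
      by (intro nn_integral_mono) (auto simp: sum_nonneg simp flip: ennreal_mult)
    also have "\<dots> = ennreal (2 * R ^ 3 * E) * (\<Sum>k\<in>?K. \<integral>\<^sup>+t. ennreal ((cmod (ift (F k) t))\<^sup>2) \<partial>lborel)"
      by (subst nn_integral_cmult, measurable, subst nn_integral_sum, measurable)
    also have "\<dots> \<le> ennreal (2 * R ^ 3 * E) * (\<Sum>k\<in>?K. ennreal (2 * pi * energy (F k)))"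
      using F by (intro mult_left_mono sum_mono plancherel_band) auto
    also have "\<dots> = ennreal (2 * R ^ 3 * E) * ennreal (2 * pi * E)"
      by (simp add: E_def sum_distrib_left)
    also have "\<dots> = ennreal (4 * pi * R ^ 3 * E\<^sup>2)"
      using R E0 by (simp add: power2_eq_square mult_ac flip: ennreal_mult)
    finally show ?thesis .
  qed
  have fin: "finite (sum_freqs N)" by (simp add: sum_freqs_def)
  have "real (card Z) \<le> 2 * R + 1"
    by (rule card_le_diameter) (use R fin in \<open>auto simp: Z_def\<close>)
  then have cardZ: "real (card Z) \<le> 3 * R" using R by simp
  have "(\<Sum>l\<in>sum_freqs N. I l) \<le> (\<Sum>l\<in>sum_freqs N. ennreal (136 * pi * R ^ 4 * T l + (if l \<in> Z then 4 * pi * R ^ 3 * E\<^sup>2 else 0)))"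
  proof (rule sum_mono)
    fix l assume "l \<in> sum_freqs N"
    show "I l \<le> ennreal (136 * pi * R ^ 4 * T l + (if l \<in> Z then 4 * pi * R ^ 3 * E\<^sup>2 else 0))"
    proof (cases "l \<in> Z")
      case True
      then show ?thesis using R T0[of l] by (intro order_trans[OF small] ennreal_leI) simp
    next
      case False
      then show ?thesis using \<open>l \<in> sum_freqs N\<close> large[of l] by (auto simp: Z_def)
    qed
  qed
  also have "\<dots> = ennreal (136 * pi * R ^ 4 * (\<Sum>l\<in>sum_freqs N. T l) + real (card Z) * (4 * pi * R ^ 3 * E\<^sup>2))"
  proof -
    have "{l \<in> sum_freqs N. l \<in> Z} = Z" by (auto simp: Z_def)
    then have "(\<Sum>l\<in>sum_freqs N. 136 * pi * R ^ 4 * T l + (if l \<in> Z then 4 * pi * R ^ 3 * E\<^sup>2 else 0)) =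
        136 * pi * R ^ 4 * (\<Sum>l\<in>sum_freqs N. T l) + real (card Z) * (4 * pi * R ^ 3 * E\<^sup>2)"
      using fin by (simp add: sum.distrib sum_distrib_left sum.If_cases Int_def)
    then show ?thesis
      using R T0 by (subst sum_ennreal) auto
  qed
  \<comment> \<open>At most \<open>3 * R\<close> small frequencies cost order \<open>R ^ 3\<close>
    each, so they match the order of the large ones; 136 + 3 * 4 = 148.\<close>
  also have "\<dots> \<le> ennreal (136 * pi * R ^ 4 * E\<^sup>2 + 3 * R * (4 * pi * R ^ 3 * E\<^sup>2))"
    using R cardZ unfolding T_def E_def
    by (intro ennreal_leI add_mono mult_left_mono mult_right_mono sum_freq_pairs_le) auto
  also have "136 * pi * R ^ 4 * E\<^sup>2 + 3 * R * (4 * pi * R ^ 3 * E\<^sup>2) = 148 * pi * R ^ 4 * E\<^sup>2"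
    by (simp add: power_numeral_reduce algebra_simps)
  finally show ?thesis unfolding I_def E_def .
qed

subsection \<open>Discrete Parseval identity\<close>

lemma sum_torus_grid:
  assumes "N > 0"
  shows "(\<Sum>x\<in>torus_grid N. f x) = (\<Sum>n\<in>{- int N..<int N}. f (mesh N * real_of_int n))"
  unfolding torus_grid_def using mesh_pos[OF assms] by (subst sum.reindex) (auto simp: inj_on_def)

lemma finite_torus_grid [simp]: "finite (torus_grid N)"
  by (simp add: torus_grid_def)

lemma cis_eq_1_iff: "cis x = 1 \<longleftrightarrow> (\<exists>n::int. x = 2 * pi * real_of_int n)"
proof
  assume "cis x = 1"
  then have "cos x = 1" by (simp add: complex_eq_iff)
  then show "\<exists>n::int. x = 2 * pi * real_of_int n"
    by (auto simp: cos_one_2pi_int mult_ac)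
next
  assume "\<exists>n::int. x = 2 * pi * real_of_int n"
  then show "cis x = 1" by (auto simp: complex_eq_iff)
qed

text \<open>Multiplication by the root \<open>?w\<close> shifts the index by one, and by periodicity
  this preserves the sum. Hence the sum vanishes unless the root is 1.\<close>

lemma sum_roots_of_unity:
  assumes N: "N > 0"
  shows "(\<Sum>n\<in>{- int N..<int N}. cis (mesh N * real_of_int n * real_of_int m)) =
    (if 2 * int N dvd m then of_nat (2 * N) else 0)"
proof (cases "2 * int N dvd m")
  case True
  then obtain p where "m = 2 * int N * p" by (auto simp: dvd_def)
  then have *: "mesh N * real_of_int n * real_of_int m = 2 * pi * real_of_int (n * p)" for n
    using mesh_mult[OF N] by (simp add: mult_ac)
  have "cis (mesh N * real_of_int n * real_of_int m) = 1" for n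
    unfolding cis_eq_1_iff using * by blast
  then show ?thesis using True by simp
next
  case False
  let ?S = "\<Sum>n\<in>{- int N..<int N}. cis (mesh N * real_of_int n * real_of_int m)"
  let ?w = "cis (mesh N * real_of_int m)"
  have "?w \<noteq> 1"
  proof
    assume "?w = 1"
    then obtain p :: int where "mesh N * real_of_int m = 2 * pi * real_of_int p"
      by (auto simp: cis_eq_1_iff)
    then have "real_of_int m = real_of_int (2 * int N * p)"
      using N by (simp add: mesh_def field_simps)
    then have "m = 2 * int N * p" by (rule of_int_eq_iff[THEN iffD1])
    with False show False by simp
  qed
  moreover have "?w * ?S = ?S"
  proof -
    let ?f = "\<lambda>n::int. cis (mesh N * real_of_int n * real_of_int m)"
    have "?w * ?S = (\<Sum>n\<in>{- int N..<int N}. ?f (n + 1))"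
      by (simp add: sum_distrib_left cis_mult algebra_simps)
    also have "\<dots> = (\<Sum>n\<in>(\<lambda>n. n + 1) ` {- int N..<int N}. ?f n)"
      by (subst sum.reindex) auto
    also have "(\<lambda>n. n + 1) ` {- int N..<int N} = insert (int N) ({- int N..<int N} - {- int N})"
      using N by (auto simp: image_iff)
    also have "(\<Sum>n\<in>insert (int N) ({- int N..<int N} - {- int N}). ?f n) = ?f (int N) + (?S - ?f (- int N))"
      using N by (subst sum.insert) (auto simp: sum_diff1)
    \<comment> \<open>The endpoint gained and the one lost agree: their angles are pi m and -pi m,
      and sin (pi m) = 0.\<close>
    also have "?f (int N) = ?f (- int N)"
    proof -
      have "mesh N * real_of_int (int N) * real_of_int m = pi * real_of_int m"
        "mesh N * real_of_int (- int N) * real_of_int m = - (pi * real_of_int m)"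
        using mesh_mult[OF N] by simp_all
      then show ?thesis
        by (simp only: complex_eq_iff cis.sel cos_minus sin_minus) (simp add: mult.commute)
    qed
    finally show ?thesis by simp
  qed
  then have "(?w - 1) * ?S = 0" by (simp add: algebra_simps)
  ultimately show ?thesis using False by simp
qed

text \<open>Any 2N consecutive integers are distinct modulo 2N, so their characters are orthogonal
  on the grid. The free starting point \<open>a\<close> lets the identity serve both halves of the
  output range.\<close>

lemma discrete_parseval:
  assumes N: "N > 0" and J: "J = {a..<a + 2 * int N}"
  shows "(\<Sum>x\<in>torus_grid N. (cmod (\<Sum>l\<in>J. cis (x * real_of_int l) * c l))\<^sup>2) = 2 * real N * (\<Sum>l\<in>J. (cmod (c l))\<^sup>2)"
proof -
  have dvd: "2 * int N dvd l - l' \<longleftrightarrow> l = l'" if "l \<in> J" "l' \<in> J" for l l'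
  proof
    assume "2 * int N dvd l - l'"
    then show "l = l'" using that J zdvd_imp_le[of "2 * int N" "l - l'"] zdvd_imp_le[of "2 * int N" "l' - l"]
      by (cases "l < l'"; cases "l' < l") (auto simp: dvd_diff_commute)
  qed simp
  have cis_diff: "cis (x * real_of_int (l - l')) = cis (x * real_of_int l) * cnj (cis (x * real_of_int l'))" for x l l'
    by (simp add: cis_cnj cis_mult right_diff_distrib)
  have sq: "complex_of_real ((cmod (\<Sum>l\<in>J. cis (x * real_of_int l) * c l))\<^sup>2) =
      (\<Sum>l\<in>J. \<Sum>l'\<in>J. c l * cnj (c l') * cis (x * real_of_int (l - l')))" for x
    unfolding complex_norm_square cnj_sum sum_product cis_diff
    by (intro sum.cong refl) (simp add: mult_ac)
  have "complex_of_real (\<Sum>x\<in>torus_grid N. (cmod (\<Sum>l\<in>J. cis (x * real_of_int l) * c l))\<^sup>2) =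
      (\<Sum>x\<in>torus_grid N. \<Sum>l\<in>J. \<Sum>l'\<in>J. c l * cnj (c l') * cis (x * real_of_int (l - l')))"
    by (simp only: of_real_sum sq)
  also have "\<dots> = (\<Sum>l\<in>J. \<Sum>l'\<in>J. c l * cnj (c l') * (\<Sum>x\<in>torus_grid N. cis (x * real_of_int (l - l'))))"
    unfolding sum_distrib_left by (subst sum.swap) (intro sum.cong refl, rule sum.swap)
  also have "\<dots> = (\<Sum>l\<in>J. \<Sum>l'\<in>J. if l' = l then of_nat (2 * N) * (c l * cnj (c l')) else 0)"
    unfolding sum_torus_grid[OF N] sum_roots_of_unity[OF N]
    using dvd by (intro sum.cong refl) auto
  also have "\<dots> = (\<Sum>l\<in>J. of_nat (2 * N) * (c l * cnj (c l)))"
    by (simp add: J)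
  also have "\<dots> = complex_of_real (2 * real N * (\<Sum>l\<in>J. (cmod (c l))\<^sup>2))"
    by (simp add: sum_distrib_left complex_norm_square[symmetric] del: of_real_power)
  finally show ?thesis by (simp only: of_real_eq_iff)
qed

text \<open>The output frequencies range over \<open>4N\<close> integers. The negative and the nonnegative ones are each
  distinct modulo \<open>2N\<close>, which costs a factor 2 but avoids reducing frequencies modulo \<open>2N\<close>.\<close>

lemma discrete_L4_bound:
  assumes N: "N > 0"
  shows "mesh N * (\<Sum>x\<in>torus_grid N. cmod (\<Sum>k\<in>grid_freqs N. cis (x * real_of_int k) * g k) ^ 4) \<le>
    4 * pi * (\<Sum>l\<in>sum_freqs N. (cmod (\<Sum>j\<in>freq_pairs N l. g j * g (l - j)))\<^sup>2)"
proof -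
  let ?K = "grid_freqs N"
  define c where "c l = (\<Sum>j\<in>freq_pairs N l. g j * g (l - j))" for l
  define A B where "A = {- 2 * int N..<0}" and "B = {0..<2 * int N}"
  have AB: "sum_freqs N = A \<union> B" "A \<inter> B = {}" "finite A" "finite B"
    by (auto simp: A_def B_def sum_freqs_def)
  define P Q where "P x = (\<Sum>l\<in>A. cis (x * real_of_int l) * c l)"
    and "Q x = (\<Sum>l\<in>B. cis (x * real_of_int l) * c l)" for x
  \<comment> \<open>Grouping the products by the integer \<open>j + k\<close> makes \<open>c\<close>
    the coefficients of the square before aliasing, as the separation estimate requires.\<close>
  have sq: "(\<Sum>k\<in>?K. cis (x * real_of_int k) * g k)\<^sup>2 = P x + Q x" for x
  proof -
    let ?f = "\<lambda>l j. cis (x * real_of_int l) * (g j * g (l - j))"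
    have "(\<Sum>k\<in>?K. cis (x * real_of_int k) * g k)\<^sup>2 = (\<Sum>j\<in>?K. \<Sum>k\<in>?K. ?f (j + k) j)"
      unfolding power2_eq_square sum_product
      by (intro sum.cong refl) (simp add: cis_mult[symmetric] algebra_simps)
    also have "\<dots> = (\<Sum>j\<in>?K. \<Sum>l\<in>{l \<in> sum_freqs N. l - j \<in> ?K}. ?f l j)"
    proof (rule sum.cong[OF refl])
      fix j assume j: "j \<in> ?K"
      show "(\<Sum>k\<in>?K. ?f (j + k) j) = (\<Sum>l\<in>{l \<in> sum_freqs N. l - j \<in> ?K}. ?f l j)"
        by (rule sum.reindex_bij_witness[of _ "\<lambda>l. l - j" "\<lambda>k. j + k"])
           (use j in \<open>auto simp: sum_freqs_def grid_freqs_def\<close>)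
    qed
    also have "\<dots> = (\<Sum>l\<in>sum_freqs N. \<Sum>j\<in>freq_pairs N l. ?f l j)"
      unfolding freq_pairs_def
      by (rule sum.swap_restrict) (auto simp: sum_freqs_def)
    also have "\<dots> = (\<Sum>l\<in>sum_freqs N. cis (x * real_of_int l) * c l)"
      by (simp add: c_def sum_distrib_left)
    also have "\<dots> = P x + Q x"
      unfolding AB(1) P_def Q_def by (rule sum.union_disjoint[OF AB(3,4,2)])
    finally show ?thesis .
  qed
  have pt: "cmod (\<Sum>k\<in>?K. cis (x * real_of_int k) * g k) ^ 4 \<le> 2 * (cmod (P x))\<^sup>2 + 2 * (cmod (Q x))\<^sup>2" for x
  proof -
    have "cmod (\<Sum>k\<in>?K. cis (x * real_of_int k) * g k) ^ 4 = (cmod (P x + Q x))\<^sup>2"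
      by (simp add: sq[symmetric] norm_power)
    also have "\<dots> \<le> (cmod (P x) + cmod (Q x))\<^sup>2"
      by (intro power_mono norm_triangle_ineq) auto
    also have "\<dots> \<le> 2 * (cmod (P x))\<^sup>2 + 2 * (cmod (Q x))\<^sup>2"
      using sum_squares_bound[of "cmod (P x)" "cmod (Q x)"] by (simp add: power2_sum)
    finally show ?thesis .
  qed
  have "mesh N * (\<Sum>x\<in>torus_grid N. cmod (\<Sum>k\<in>?K. cis (x * real_of_int k) * g k) ^ 4) \<le>
      mesh N * (\<Sum>x\<in>torus_grid N. 2 * (cmod (P x))\<^sup>2 + 2 * (cmod (Q x))\<^sup>2)"
    using mesh_pos[OF N] by (intro mult_left_mono sum_mono pt) auto
  also have "\<dots> = mesh N * (2 * (\<Sum>x\<in>torus_grid N. (cmod (P x))\<^sup>2) + 2 * (\<Sum>x\<in>torus_grid N. (cmod (Q x))\<^sup>2))"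
    by (simp add: sum.distrib sum_distrib_left)
  also have "(\<Sum>x\<in>torus_grid N. (cmod (P x))\<^sup>2) = 2 * real N * (\<Sum>l\<in>A. (cmod (c l))\<^sup>2)"
    unfolding P_def by (rule discrete_parseval[OF N, where a = "- 2 * int N"]) (simp add: A_def)
  also have "(\<Sum>x\<in>torus_grid N. (cmod (Q x))\<^sup>2) = 2 * real N * (\<Sum>l\<in>B. (cmod (c l))\<^sup>2)"
    unfolding Q_def by (rule discrete_parseval[OF N, where a = 0]) (simp add: B_def)
  \<comment> \<open>The factor 2 from splitting into \<open>P\<close> and \<open>Q\<close>, times h
    * 2N = 2 pi, gives \<open>4 * pi\<close>.\<close>
  also have "mesh N * (2 * (2 * real N * (\<Sum>l\<in>A. (cmod (c l))\<^sup>2)) + 2 * (2 * real N * (\<Sum>l\<in>B. (cmod (c l))\<^sup>2))) =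
      4 * (mesh N * real N) * ((\<Sum>l\<in>A. (cmod (c l))\<^sup>2) + (\<Sum>l\<in>B. (cmod (c l))\<^sup>2))"
    by (simp add: algebra_simps)
  also have "(\<Sum>l\<in>A. (cmod (c l))\<^sup>2) + (\<Sum>l\<in>B. (cmod (c l))\<^sup>2) = (\<Sum>l\<in>sum_freqs N. (cmod (c l))\<^sup>2)"
    unfolding AB(1) by (rule sum.union_disjoint[OF AB(3,4,2), symmetric])
  finally show ?thesis unfolding mesh_mult[OF N] c_def .
qed

section \<open>Fourth powers of single blocks and their summation\<close>

definition synth :: "nat \<Rightarrow> (int \<Rightarrow> real \<Rightarrow> complex) \<Rightarrow> real \<Rightarrow> real \<Rightarrow> complex" where
  "synth N F t x = (\<Sum>k\<in>grid_freqs N. cis (x * real_of_int k) * ift (F k) t)"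

definition L4_slice :: "nat \<Rightarrow> (real \<Rightarrow> complex) \<Rightarrow> real" where
  "L4_slice N g = mesh N * (\<Sum>x\<in>torus_grid N. cmod (g x) ^ 4)"

lemma synth_measurable:
  assumes "\<And>k. k \<in> grid_freqs N \<Longrightarrow> F k \<in> borel_measurable borel"
  shows "(\<lambda>t. synth N F t x) \<in> borel_measurable borel"
  unfolding synth_def by (intro borel_measurable_sum borel_measurable_times ift_borel_measurable assms) auto

lemma block_L4_bound:
  assumes N: "N > 0" and \<sigma>: "\<sigma> \<in> {1, - 1}" and R: "1 \<le> R"
    and F: "\<And>k. k \<in> grid_freqs N \<Longrightarrow> band (\<sigma> * dispersion N k) (R ^ 3) (F k)"
  shows "(\<integral>\<^sup>+t. ennreal (L4_slice N (synth N F t)) \<partial>lborel) \<le>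
    ennreal (592 * pi\<^sup>2 * R ^ 4 * (\<Sum>k\<in>grid_freqs N. energy (F k))\<^sup>2)"
proof -
  have [measurable]: "ift (F k) \<in> borel_measurable borel" if "k \<in> grid_freqs N" for k
    using F[OF that] by (intro ift_borel_measurable) (auto simp: band_def)
  let ?c = "\<lambda>l t. (cmod (\<Sum>j\<in>freq_pairs N l. ift (F j) t * ift (F (l - j)) t))\<^sup>2"
  have m [measurable]: "?c l \<in> borel_measurable borel" for l
    by (intro borel_measurable_power borel_measurable_norm borel_measurable_sum borel_measurable_times)
       (auto simp: freq_pairs_def)
  have "(\<integral>\<^sup>+t. ennreal (L4_slice N (synth N F t)) \<partial>lborel) \<le> (\<integral>\<^sup>+t. ennreal (4 * pi) * (\<Sum>l\<in>sum_freqs N. ennreal (?c l t)) \<partial>lborel)"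
    unfolding L4_slice_def synth_def
    by (intro nn_integral_mono order_trans[OF ennreal_leI[OF discrete_L4_bound[OF N]]])
       (simp add: ennreal_mult sum_nonneg)
  also have "\<dots> = ennreal (4 * pi) * (\<Sum>l\<in>sum_freqs N. \<integral>\<^sup>+t. ennreal (?c l t) \<partial>lborel)"
    by (subst nn_integral_cmult, measurable, subst nn_integral_sum, measurable)
  also have "\<dots> \<le> ennreal (4 * pi) * ennreal (148 * pi * R ^ 4 * (\<Sum>k\<in>grid_freqs N. energy (F k))\<^sup>2)"
    by (intro mult_left_mono block_bound[OF N \<sigma> R F]) auto
  also have "\<dots> = ennreal (592 * pi\<^sup>2 * R ^ 4 * (\<Sum>k\<in>grid_freqs N. energy (F k))\<^sup>2)"
    using R by (simp add: power2_eq_square mult_ac flip: ennreal_mult)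
  finally show ?thesis .
qed

text \<open>Hoelder's inequality with geometric weights, obtained from Cauchy-Schwarz twice. Applied
  pointwise, it replaces the triangle inequality in L^4 when the blocks are added, so that only
  fourth powers have to be integrated.\<close>

lemma fourth_power_sum_le:
  fixes a :: "nat \<Rightarrow> real"
  assumes d: "0 < d" "d < 1" and a: "\<And>m. 0 \<le> a m"
  shows "(\<Sum>m<n. a m) ^ 4 \<le> (1 / (1 - d)) ^ 3 * (\<Sum>m<n. a m ^ 4 / d ^ (3 * m))"
proof -
  define D where "D = (\<Sum>m<n. d ^ m)"
  define B where "B = (\<Sum>m<n. (a m)\<^sup>2 / d ^ m)"
  have D: "0 \<le> D" "D \<le> 1 / (1 - d)"
    using d by (auto simp: D_def sum_nonneg) (simp add: sum_gp_strict divide_right_mono)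
  have B: "0 \<le> B" unfolding B_def using d by (intro sum_nonneg) auto
  have s: "(sqrt (d ^ m))\<^sup>2 = d ^ m" "0 < sqrt (d ^ m)" for m using d by auto
  have "(\<Sum>m<n. a m)\<^sup>2 = (\<Sum>m<n. sqrt (d ^ m) * (a m / sqrt (d ^ m)))\<^sup>2"
    using d by simp
  also have "\<dots> \<le> D * B"
    using Cauchy_Schwarz_ineq_sum[of "\<lambda>m. sqrt (d ^ m)" "\<lambda>m. a m / sqrt (d ^ m)" "{..<n}"]
    by (simp only: D_def B_def power_divide s)
  finally have 1: "(\<Sum>m<n. a m)\<^sup>2 \<le> D * B" .
  \<comment> \<open>The split of \<open>(a m)\<^sup>2 / d ^ m\<close> for the second Cauchy-Schwarz:
    the first factor squares to \<open>d ^ m\<close>, the second, by \<open>f\<close>, to the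
    weighted fourth power.\<close>
  have e: "sqrt (d ^ m) * ((a m)\<^sup>2 / (d ^ m * sqrt (d ^ m))) = (a m)\<^sup>2 / d ^ m" for m
    using s(2)[of m] by simp
  have f: "((a m)\<^sup>2 / (d ^ m * sqrt (d ^ m)))\<^sup>2 = a m ^ 4 / d ^ (3 * m)" for m
  proof -
    have "((a m)\<^sup>2 / (d ^ m * sqrt (d ^ m)))\<^sup>2 = ((a m)\<^sup>2)\<^sup>2 / ((d ^ m)\<^sup>2 * d ^ m)"
      by (simp only: power_divide power_mult_distrib s)
    also have "\<dots> = a m ^ 4 / d ^ (3 * m)"
      by (simp flip: power_mult power_add add: mult.commute)
    finally show ?thesis .
  qed
  have "B\<^sup>2 \<le> D * (\<Sum>m<n. a m ^ 4 / d ^ (3 * m))"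
    using Cauchy_Schwarz_ineq_sum[of "\<lambda>m. sqrt (d ^ m)" "\<lambda>m. (a m)\<^sup>2 / (d ^ m * sqrt (d ^ m))" "{..<n}"]
    by (simp only: e f s D_def B_def)
  then have "D\<^sup>2 * B\<^sup>2 \<le> D ^ 3 * (\<Sum>m<n. a m ^ 4 / d ^ (3 * m))"
    using D mult_left_mono[of "B\<^sup>2" "D * (\<Sum>m<n. a m ^ 4 / d ^ (3 * m))" "D\<^sup>2"]
    by (simp add: power2_eq_square power3_eq_cube mult_ac)
  moreover have "(\<Sum>m<n. a m) ^ 4 \<le> D\<^sup>2 * B\<^sup>2"
    using power_mono[OF 1, of 2] by (simp add: power_mult_distrib flip: power_mult)
  moreover have "D ^ 3 * (\<Sum>m<n. a m ^ 4 / d ^ (3 * m)) \<le> (1 / (1 - d)) ^ 3 * (\<Sum>m<n. a m ^ 4 / d ^ (3 * m))"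
    using D d a by (intro mult_right_mono power_mono sum_nonneg) auto
  ultimately show ?thesis by linarith
qed

subsection \<open>Dyadic decomposition in the modulation\<close>

lemma bracket_ge: "1 \<le> bracket a" "\<bar>a\<bar> \<le> bracket a"
  by (auto simp: bracket_def intro!: real_le_rsqrt)

lemma borel_measurable_bracket [measurable (raw)]:
  "f \<in> borel_measurable M \<Longrightarrow> (\<lambda>x. bracket (f x)) \<in> borel_measurable M"
  unfolding bracket_def by measurable

text \<open>Because \<open>bracket\<close> is at least 1, the shells from \<open>m = 0\<close> on
  cover every frequency and leave no low-modulation remainder. Sharp cut-offs do, since each block
  is estimated only through the size and support of its transform.\<close>

definition shell :: "nat \<Rightarrow> real \<Rightarrow> (int \<Rightarrow> real \<Rightarrow> complex) \<Rightarrow> nat \<Rightarrow> int \<Rightarrow> real \<Rightarrow> complex" where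
  "shell N \<sigma> F m k \<tau> =
     (if 2 ^ m \<le> bracket (\<tau> - \<sigma> * dispersion N k) \<and> bracket (\<tau> - \<sigma> * dispersion N k) < 2 ^ Suc m
      then F k \<tau> else 0)"

lemma shell_measurable:
  assumes [measurable]: "F k \<in> borel_measurable borel"
  shows "shell N \<sigma> F m k \<in> borel_measurable borel"
  unfolding shell_def[abs_def] by measurable

lemma band_shell:
  assumes "F k \<in> borel_measurable borel" and B: "\<And>\<tau>. cmod (F k \<tau>) \<le> B"
  shows "band (\<sigma> * dispersion N k) (2 ^ Suc m) (shell N \<sigma> F m k)"
  unfolding band_def
proof (intro conjI allI impI exI)
  show "shell N \<sigma> F m k \<in> borel_measurable borel" using assms(1) by (rule shell_measurable)
  show "cmod (shell N \<sigma> F m k \<tau>) \<le> B" for \<tau>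
    using B[of \<tau>] order_trans[OF norm_ge_zero B] by (simp add: shell_def)
  show "shell N \<sigma> F m k \<tau> = 0" if "2 ^ Suc m < \<bar>\<tau> - \<sigma> * dispersion N k\<bar>" for \<tau>
    using that bracket_ge(2)[of "\<tau> - \<sigma> * dispersion N k"] by (auto simp: shell_def)
qed

lemma sum_shell:
  "(\<Sum>m<n. shell N \<sigma> F m k \<tau>) = (if bracket (\<tau> - \<sigma> * dispersion N k) < 2 ^ n then F k \<tau> else 0)"
proof (induction n)
  case 0
  then show ?case using bracket_ge(1)[of "\<tau> - \<sigma> * dispersion N k"] by simp
next
  case (Suc n)
  have "x < 2 ^ Suc n" if "x < 2 ^ n" for x :: real
    by (rule less_le_trans[OF that]) simp
  then show ?case unfolding sum.lessThan_Suc Suc by (auto simp: shell_def simp del: power_Suc)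
qed

text \<open>At a fixed \<tau> at most one shell is active, and on it 2^m is at most the bracket, so
  a single term bounded by the weight survives.\<close>

lemma shell_weight:
  assumes b: "b \<ge> 0"
  shows "(\<Sum>m<n. 2 powr (2 * b * real m) * (cmod (shell N \<sigma> F m k \<tau>))\<^sup>2) \<le>
    bracket (\<tau> - \<sigma> * dispersion N k) powr (2 * b) * (cmod (F k \<tau>))\<^sup>2"
proof -
  let ?x = "bracket (\<tau> - \<sigma> * dispersion N k)"
  define P where "P m \<longleftrightarrow> 2 ^ m \<le> ?x \<and> ?x < 2 ^ Suc m" for m
  have uniq: "m \<le> m'" if "P m" "P m'" for m m'
  proof -
    have "(2::real) ^ m < 2 ^ Suc m'" using that by (auto simp: P_def)
    then show ?thesis by (simp del: power_Suc)
  qed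
  have "(\<Sum>m<n. 2 powr (2 * b * real m) * (cmod (shell N \<sigma> F m k \<tau>))\<^sup>2) \<le>
      (\<Sum>m<n. if P m then ?x powr (2 * b) * (cmod (F k \<tau>))\<^sup>2 else 0)"
  proof (rule sum_mono)
    fix m
    have "2 powr (2 * b * real m) \<le> ?x powr (2 * b)" if "P m"
    proof -
      have "2 powr (2 * b * real m) = (2 ^ m) powr (2 * b)"
        by (simp add: powr_powr mult.commute flip: powr_realpow)
      also have "\<dots> \<le> ?x powr (2 * b)"
        using that b by (intro powr_mono2) (auto simp: P_def)
      finally show ?thesis .
    qed
    then show "2 powr (2 * b * real m) * (cmod (shell N \<sigma> F m k \<tau>))\<^sup>2 \<le>
        (if P m then ?x powr (2 * b) * (cmod (F k \<tau>))\<^sup>2 else 0)"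
      by (auto simp: shell_def P_def intro!: mult_right_mono)
  qed
  also have "\<dots> = real (card {m \<in> {..<n}. P m}) * (?x powr (2 * b) * (cmod (F k \<tau>))\<^sup>2)"
    by (simp add: sum.If_cases Int_def)
  also have "\<dots> \<le> 1 * (?x powr (2 * b) * (cmod (F k \<tau>))\<^sup>2)"
  proof (intro mult_right_mono)
    have "card {m \<in> {..<n}. P m} \<le> 1"
      unfolding One_nat_def by (rule card_le_Suc0_iff_eq[THEN iffD2]) (auto intro: antisym uniq)
    then show "real (card {m \<in> {..<n}. P m}) \<le> 1" by linarith
  qed auto
  finally show ?thesis by simp
qed

definition weighted_energy :: "nat \<Rightarrow> real \<Rightarrow> real \<Rightarrow> (int \<Rightarrow> real \<Rightarrow> complex) \<Rightarrow> real" where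
  "weighted_energy N \<sigma> b F =
     (\<Sum>k\<in>grid_freqs N. LINT \<tau>|lborel. bracket (\<tau> - \<sigma> * dispersion N k) powr (2 * b) * (cmod (F k \<tau>))\<^sup>2)"

lemma weighted_energy_nonneg: "0 \<le> weighted_energy N \<sigma> b F"
  unfolding weighted_energy_def by (intro sum_nonneg Bochner_Integration.integral_nonneg) auto

text \<open>Boundedness makes the shells bands, integrability permits the truncation limit, and the
  weighted condition keeps the integrals in \<open>weighted_energy\<close> from being the default
  value 0.\<close>

definition weighted_family :: "nat \<Rightarrow> real \<Rightarrow> real \<Rightarrow> (int \<Rightarrow> real \<Rightarrow> complex) \<Rightarrow> bool" where
  "weighted_family N \<sigma> b F \<longleftrightarrow> (\<forall>k\<in>grid_freqs N. integrable lborel (F k) \<and> (\<exists>B. \<forall>\<tau>. cmod (F k \<tau>) \<le> B) \<and>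
     integrable lborel (\<lambda>\<tau>. bracket (\<tau> - \<sigma> * dispersion N k) powr (2 * b) * (cmod (F k \<tau>))\<^sup>2))"

lemma sum_shell_energy:
  assumes F: "weighted_family N \<sigma> b F" and b: "b \<ge> 0"
  shows "(\<Sum>m<n. 2 powr (2 * b * real m) * (\<Sum>k\<in>grid_freqs N. energy (shell N \<sigma> F m k))) \<le> weighted_energy N \<sigma> b F"
proof -
  have "(\<Sum>m<n. 2 powr (2 * b * real m) * (\<Sum>k\<in>grid_freqs N. energy (shell N \<sigma> F m k))) =
      (\<Sum>k\<in>grid_freqs N. \<Sum>m<n. 2 powr (2 * b * real m) * energy (shell N \<sigma> F m k))"
    unfolding sum_distrib_left by (rule sum.swap)
  also have "\<dots> \<le> weighted_energy N \<sigma> b F"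
    unfolding weighted_energy_def
  proof (rule sum_mono)
    fix k assume "k \<in> grid_freqs N"
    then obtain B where F_int: "integrable lborel (F k)" and B: "\<And>\<tau>. cmod (F k \<tau>) \<le> B"
      and W: "integrable lborel (\<lambda>\<tau>. bracket (\<tau> - \<sigma> * dispersion N k) powr (2 * b) * (cmod (F k \<tau>))\<^sup>2)"
      using F by (auto simp: weighted_family_def)
    have "band (\<sigma> * dispersion N k) (2 ^ Suc m) (shell N \<sigma> F m k)" for m
      using F_int B by (intro band_shell) auto
    note sqi = band_square_integrable[OF this]
    have "(\<Sum>m<n. 2 powr (2 * b * real m) * energy (shell N \<sigma> F m k)) =
        (LINT \<tau>|lborel. (\<Sum>m<n. 2 powr (2 * b * real m) * (cmod (shell N \<sigma> F m k \<tau>))\<^sup>2))"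
      unfolding energy_def using sqi by (simp add: Bochner_Integration.integral_sum)
    also have "\<dots> \<le> (LINT \<tau>|lborel. bracket (\<tau> - \<sigma> * dispersion N k) powr (2 * b) * (cmod (F k \<tau>))\<^sup>2)"
      using sqi by (intro integral_mono W shell_weight b) auto
    finally show "(\<Sum>m<n. 2 powr (2 * b * real m) * energy (shell N \<sigma> F m k)) \<le>
        (LINT \<tau>|lborel. bracket (\<tau> - \<sigma> * dispersion N k) powr (2 * b) * (cmod (F k \<tau>))\<^sup>2)" .
  qed
  finally show ?thesis .
qed

text \<open>The block estimates produce squares of weighted shell energies, whereas the modulation
  norm controls their sum.\<close>

lemma sum_squares_le_square_sum:
  fixes q :: "nat \<Rightarrow> real"
  assumes "\<And>m. 0 \<le> q m"
  shows "(\<Sum>m<n. (q m)\<^sup>2) \<le> (\<Sum>m<n. q m)\<^sup>2"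
proof -
  have "(\<Sum>m<n. (q m)\<^sup>2) \<le> (\<Sum>m<n. q m * (\<Sum>m<n. q m))"
    unfolding power2_eq_square using assms
    by (intro sum_mono mult_left_mono member_le_sum) auto
  also have "\<dots> = (\<Sum>m<n. q m)\<^sup>2" by (simp add: power2_eq_square sum_distrib_right)
  finally show ?thesis .
qed

lemma L4_slice_measurable:
  assumes [measurable]: "\<And>x. x \<in> torus_grid N \<Longrightarrow> (\<lambda>t. g t x) \<in> borel_measurable M"
  shows "(\<lambda>t. L4_slice N (g t)) \<in> borel_measurable M"
  unfolding L4_slice_def by measurable

lemma L4_slice_nonneg: "0 \<le> L4_slice N g"
  by (simp add: L4_slice_def mesh_def sum_nonneg)

text \<open>\<open>d = decay b\<close> is chosen such that the weights \<open>d\<^bsup>-3m\<^esup>\<close> of \<open>fourth_power_sum_le\<close> turn the factors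
  \<open>2\<^bsup>4m/3\<^esup>\<close> of the single blocks into \<open>2\<^bsup>4bm\<^esup>\<close>; it is below 1 exactly when \<open>b > 1/3\<close>.\<close>

definition decay :: "real \<Rightarrow> real" where
  "decay b = 2 powr (4 / 9 - 4 * b / 3)"

text \<open>The cube comes from \<open>fourth_power_sum_le\<close>, 592 pi^2 from the estimate of
  one block, and \<open>2 powr (4 / 3)\<close> from the radius of shell \<open>m\<close> being
  2^(m+1) rather than 2^m.\<close>

definition L4_const :: "real \<Rightarrow> real" where
  "L4_const b = (1 / (1 - decay b)) ^ 3 * (592 * pi\<^sup>2 * 2 powr (4 / 3))"

lemma decay_bounds: "b > 1 / 3 \<Longrightarrow> 0 < decay b" "b > 1 / 3 \<Longrightarrow> decay b < 1"
proof -
  assume "b > 1 / 3"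
  then have "2 powr (4 / 9 - 4 * b / 3) < 2 powr (0::real)" by (intro powr_less_mono) auto
  then show "decay b < 1" by (simp add: decay_def)
qed (simp add: decay_def)

lemma L4_const_pos: "b > 1 / 3 \<Longrightarrow> 0 < L4_const b"
  using decay_bounds[of b] by (simp add: L4_const_def)

text \<open>The weights of the pointwise summation convert the block bounds into squares of 2^(2bm)
  times the shell energies, whose sum the weighted energy controls. The bound is independent of
  \<open>n\<close>, so the truncation can be removed afterwards.\<close>

lemma dyadic_L4_bound:
  assumes N: "N > 0" and \<sigma>: "\<sigma> \<in> {1, - 1}" and b: "b > 1 / 3" and F: "weighted_family N \<sigma> b F"
  shows "(\<integral>\<^sup>+t. ennreal (L4_slice N (\<lambda>x. \<Sum>m<n. synth N (shell N \<sigma> F m) t x)) \<partial>lborel) \<le>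
    ennreal (L4_const b * (weighted_energy N \<sigma> b F)\<^sup>2)"
proof -
  let ?d = "decay b" and ?c = "(1 / (1 - decay b)) ^ 3"
  define E where "E m = (\<Sum>k\<in>grid_freqs N. energy (shell N \<sigma> F m k))" for m
  \<comment> \<open>The cube of \<open>R m\<close> is the radius \<open>2 ^ Suc m\<close> of the
    bands in \<open>band_shell\<close>.\<close>
  define R where "R m = 2 powr (real (Suc m) / 3)" for m
  note d = decay_bounds[OF b]
  have c: "0 \<le> ?c" using d by simp
  have E0: "0 \<le> E m" for m by (simp add: E_def sum_nonneg)
  have R1: "1 \<le> R m" for m by (simp add: R_def ge_one_powr_ge_zero)
  have R3: "R m ^ 3 = 2 ^ Suc m" for m
    by (simp add: R_def powr_realpow[symmetric] powr_powr del: power_Suc of_nat_Suc)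
  have bd: "band (\<sigma> * dispersion N k) (R m ^ 3) (shell N \<sigma> F m k)" if "k \<in> grid_freqs N" for k m
  proof -
    from F that obtain B where "integrable lborel (F k)" "\<And>\<tau>. cmod (F k \<tau>) \<le> B"
      by (auto simp: weighted_family_def)
    then show ?thesis unfolding R3 by (intro band_shell) auto
  qed
  have [measurable]: "(\<lambda>t. synth N (shell N \<sigma> F m) t x) \<in> borel_measurable borel" for m x
    using bd by (intro synth_measurable) (auto simp: band_def)
  have [measurable]: "(\<lambda>t. L4_slice N (synth N (shell N \<sigma> F m) t)) \<in> borel_measurable borel" for m
    by (intro L4_slice_measurable) simp
  have pt: "L4_slice N (\<lambda>x. \<Sum>m<n. synth N (shell N \<sigma> F m) t x) \<le>
      (\<Sum>m<n. ?c / ?d ^ (3 * m) * L4_slice N (synth N (shell N \<sigma> F m) t))" for t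
  proof -
    let ?u = "\<lambda>m x. synth N (shell N \<sigma> F m) t x"
    have "cmod (\<Sum>m<n. ?u m x) ^ 4 \<le> ?c * (\<Sum>m<n. cmod (?u m x) ^ 4 / ?d ^ (3 * m))" for x
      by (rule order_trans[OF power_mono[OF norm_sum] fourth_power_sum_le]) (use d in auto)
    then have "L4_slice N (\<lambda>x. \<Sum>m<n. ?u m x) \<le>
        mesh N * (\<Sum>x\<in>torus_grid N. ?c * (\<Sum>m<n. cmod (?u m x) ^ 4 / ?d ^ (3 * m)))"
      unfolding L4_slice_def using mesh_pos[OF N] by (intro mult_left_mono sum_mono) auto
    also have "\<dots> = (\<Sum>m<n. ?c / ?d ^ (3 * m) * L4_slice N (?u m))"
      unfolding L4_slice_def sum_distrib_left
      by (subst sum.swap) (simp add: mult_ac)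
    finally show ?thesis .
  qed
  have powers: "R m ^ 4 / ?d ^ (3 * m) = 2 powr (4 / 3) * (2 powr (2 * b * real m))\<^sup>2" for m
  proof -
    have "R m ^ 4 / ?d ^ (3 * m) = 2 powr (real (Suc m) / 3 * 4 - (4 / 9 - 4 * b / 3) * real (3 * m))"
    proof -
      have "R m ^ 4 = 2 powr (real (Suc m) / 3 * 4)"
        by (simp add: R_def powr_realpow[symmetric] powr_powr del: of_nat_Suc)
      moreover have "?d ^ (3 * m) = 2 powr ((4 / 9 - 4 * b / 3) * real (3 * m))"
        unfolding decay_def by (subst powr_realpow[symmetric]) (simp_all only: powr_powr, simp)
      ultimately show ?thesis by (simp only: powr_diff)
    qed
    also have "real (Suc m) / 3 * 4 - (4 / 9 - 4 * b / 3) * real (3 * m) = 4 / 3 + (2 * b * real m) * 2"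
      by (simp add: field_simps)
    also have "2 powr (4 / 3 + (2 * b * real m) * 2) = 2 powr (4 / 3) * (2 powr (2 * b * real m))\<^sup>2"
      by (simp add: powr_add powr_realpow[symmetric] powr_powr)
    finally show ?thesis .
  qed
  have "(\<integral>\<^sup>+t. ennreal (L4_slice N (\<lambda>x. \<Sum>m<n. synth N (shell N \<sigma> F m) t x)) \<partial>lborel) \<le>
      (\<integral>\<^sup>+t. (\<Sum>m<n. ennreal (?c / ?d ^ (3 * m)) * ennreal (L4_slice N (synth N (shell N \<sigma> F m) t))) \<partial>lborel)"
  proof (rule nn_integral_mono)
    fix t
    have "(\<Sum>m<n. ennreal (?c / ?d ^ (3 * m)) * ennreal (L4_slice N (synth N (shell N \<sigma> F m) t))) =
        (\<Sum>m<n. ennreal (?c / ?d ^ (3 * m) * L4_slice N (synth N (shell N \<sigma> F m) t)))"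
      using c d L4_slice_nonneg by (intro sum.cong refl ennreal_mult[symmetric]) auto
    also have "\<dots> = ennreal (\<Sum>m<n. ?c / ?d ^ (3 * m) * L4_slice N (synth N (shell N \<sigma> F m) t))"
      using c d L4_slice_nonneg by (intro sum_ennreal mult_nonneg_nonneg) auto
    finally show "ennreal (L4_slice N (\<lambda>x. \<Sum>m<n. synth N (shell N \<sigma> F m) t x)) \<le>
        (\<Sum>m<n. ennreal (?c / ?d ^ (3 * m)) * ennreal (L4_slice N (synth N (shell N \<sigma> F m) t)))"
      using pt[of t] by (simp add: ennreal_leI)
  qed
  also have "\<dots> = (\<Sum>m<n. ennreal (?c / ?d ^ (3 * m)) * (\<integral>\<^sup>+t. ennreal (L4_slice N (synth N (shell N \<sigma> F m) t)) \<partial>lborel))"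
    by (subst nn_integral_sum, measurable, subst nn_integral_cmult, measurable)
  also have "\<dots> \<le> (\<Sum>m<n. ennreal (?c / ?d ^ (3 * m)) * ennreal (592 * pi\<^sup>2 * R m ^ 4 * (E m)\<^sup>2))"
    unfolding E_def by (intro sum_mono mult_left_mono block_L4_bound[OF N \<sigma> R1 bd]) auto
  also have "\<dots> = ennreal (\<Sum>m<n. ?c / ?d ^ (3 * m) * (592 * pi\<^sup>2 * R m ^ 4 * (E m)\<^sup>2))"
    using c d R1 by (simp add: ennreal_mult[symmetric] sum_ennreal)
  also have "(\<Sum>m<n. ?c / ?d ^ (3 * m) * (592 * pi\<^sup>2 * R m ^ 4 * (E m)\<^sup>2)) =
      (\<Sum>m<n. L4_const b * (2 powr (2 * b * real m) * E m)\<^sup>2)"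
  proof (rule sum.cong[OF refl])
    fix m
    have "?c / ?d ^ (3 * m) * (592 * pi\<^sup>2 * R m ^ 4 * (E m)\<^sup>2) =
        ?c * (592 * pi\<^sup>2) * (R m ^ 4 / ?d ^ (3 * m)) * (E m)\<^sup>2" by simp
    also have "\<dots> = L4_const b * (2 powr (2 * b * real m) * E m)\<^sup>2"
      unfolding powers L4_const_def by (simp add: power_mult_distrib)
    finally show "?c / ?d ^ (3 * m) * (592 * pi\<^sup>2 * R m ^ 4 * (E m)\<^sup>2) = \<dots>" .
  qed
  also have "\<dots> = L4_const b * (\<Sum>m<n. (2 powr (2 * b * real m) * E m)\<^sup>2)"
    by (simp add: sum_distrib_left)
  also have "ennreal \<dots> \<le> ennreal (L4_const b * (\<Sum>m<n. 2 powr (2 * b * real m) * E m)\<^sup>2)"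
    using L4_const_pos[OF b] E0
    by (intro ennreal_leI mult_left_mono sum_squares_le_square_sum) auto
  also have "\<dots> \<le> ennreal (L4_const b * (weighted_energy N \<sigma> b F)\<^sup>2)"
  proof -
    have "(\<Sum>m<n. 2 powr (2 * b * real m) * E m) \<le> weighted_energy N \<sigma> b F"
      unfolding E_def using b by (intro sum_shell_energy[OF F]) auto
    moreover have "0 \<le> (\<Sum>m<n. 2 powr (2 * b * real m) * E m)" using E0 by (intro sum_nonneg) auto
    ultimately show ?thesis
      using L4_const_pos[OF b] by (intro ennreal_leI mult_left_mono power_mono) auto
  qed
  finally show ?thesis .
qed

section \<open>Removal of the truncation in modulation\<close>

lemma ift_truncation_tendsto:
  assumes "integrable lborel (F k)"
  shows "(\<lambda>n. \<Sum>m<n. ift (shell N \<sigma> F m k) t) \<longlonglongrightarrow> ift (F k) t"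
proof -
  have [measurable]: "F k \<in> borel_measurable borel" using assms by auto
  let ?x = "\<lambda>\<tau>. bracket (\<tau> - \<sigma> * dispersion N k)"
  have sh: "integrable lborel (shell N \<sigma> F m k)" for m
    by (rule Bochner_Integration.integrable_bound[OF assms])
       (auto simp: shell_def intro!: shell_measurable[unfolded shell_def[abs_def]] simp: shell_def[abs_def])
  have "(\<Sum>m<n. ift (shell N \<sigma> F m k) t) = (LINT \<tau>|lborel. cis (t * \<tau>) * (if ?x \<tau> < 2 ^ n then F k \<tau> else 0))" for n
    using ift_sum[of "{..<n}" "\<lambda>m. shell N \<sigma> F m k" t] sh by (simp add: sum_shell ift_def)
  moreover have "(\<lambda>n. LINT \<tau>|lborel. cis (t * \<tau>) * (if ?x \<tau> < 2 ^ n then F k \<tau> else 0)) \<longlonglongrightarrow> ift (F k) t"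
    unfolding ift_def
  proof (rule integral_dominated_convergence[where w = "\<lambda>\<tau>. cmod (F k \<tau>)"])
    show "AE \<tau> in lborel. (\<lambda>n. cis (t * \<tau>) * (if ?x \<tau> < 2 ^ n then F k \<tau> else 0)) \<longlonglongrightarrow> cis (t * \<tau>) * F k \<tau>"
    proof (intro AE_I2 tendsto_mult tendsto_const)
      fix \<tau> :: real
      obtain n0 where n0: "?x \<tau> < 2 ^ n0" using real_arch_pow[of 2 "?x \<tau>"] by auto
      have "\<forall>\<^sub>F n in sequentially. (if ?x \<tau> < 2 ^ n then F k \<tau> else 0) = F k \<tau>"
        using eventually_ge_at_top[of n0]
      proof eventually_elim
        fix n assume "n0 \<le> n"
        then have "?x \<tau> < 2 ^ n" by (intro less_le_trans[OF n0]) simp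
        then show "(if ?x \<tau> < 2 ^ n then F k \<tau> else 0) = F k \<tau>" by simp
      qed
      then show "(\<lambda>n. if ?x \<tau> < 2 ^ n then F k \<tau> else 0) \<longlonglongrightarrow> F k \<tau>"
        by (rule tendsto_eventually)
    qed
  qed (use assms in \<open>auto simp: norm_mult\<close>)
  ultimately show ?thesis by simp
qed

lemma L4_slice_tendsto:
  assumes "\<And>x. x \<in> torus_grid N \<Longrightarrow> (\<lambda>n. g n x) \<longlonglongrightarrow> f x"
  shows "(\<lambda>n. L4_slice N (g n)) \<longlonglongrightarrow> L4_slice N f"
  unfolding L4_slice_def by (intro tendsto_intros assms)

text \<open>The truncated sums converge at every point, so Fatou passes the uniform dyadic bound to
  the limit.\<close>

lemma synth_L4_bound:
  assumes N: "N > 0" and \<sigma>: "\<sigma> \<in> {1, - 1}" and b: "b > 1 / 3" and F: "weighted_family N \<sigma> b F"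
  shows "(\<integral>\<^sup>+t. ennreal (L4_slice N (synth N F t)) \<partial>lborel) \<le>
    ennreal (L4_const b * (weighted_energy N \<sigma> b F)\<^sup>2)"
proof -
  let ?g = "\<lambda>n t x. \<Sum>m<n. synth N (shell N \<sigma> F m) t x"
  have [measurable]: "(\<lambda>t. synth N (shell N \<sigma> F m) t x) \<in> borel_measurable borel" for m x
    using F by (intro synth_measurable shell_measurable) (auto simp: weighted_family_def)
  have meas: "(\<lambda>t. L4_slice N (?g n t)) \<in> borel_measurable borel" for n
    by (intro L4_slice_measurable) simp
  have "(\<lambda>n. ?g n t x) \<longlonglongrightarrow> synth N F t x" for t x
  proof -
    have "?g n t x = (\<Sum>k\<in>grid_freqs N. cis (x * real_of_int k) * (\<Sum>m<n. ift (shell N \<sigma> F m k) t))" for n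
      unfolding synth_def sum_distrib_left by (rule sum.swap)
    then show ?thesis
      unfolding synth_def[of N F] using F
      by (auto intro!: tendsto_sum tendsto_mult tendsto_const ift_truncation_tendsto simp: weighted_family_def)
  qed
  then have lim: "(\<lambda>n. ennreal (L4_slice N (?g n t))) \<longlonglongrightarrow> ennreal (L4_slice N (synth N F t))" for t
    by (intro tendsto_ennrealI L4_slice_tendsto)
  have "(\<integral>\<^sup>+t. ennreal (L4_slice N (synth N F t)) \<partial>lborel) =
      (\<integral>\<^sup>+t. liminf (\<lambda>n. ennreal (L4_slice N (?g n t))) \<partial>lborel)"
    using lim_imp_Liminf[OF _ lim] by simp
  also have "\<dots> \<le> liminf (\<lambda>n. \<integral>\<^sup>+t. ennreal (L4_slice N (?g n t)) \<partial>lborel)"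
    using meas by (intro nn_integral_liminf) auto
  also have "\<dots> \<le> liminf (\<lambda>n. ennreal (L4_const b * (weighted_energy N \<sigma> b F)\<^sup>2))"
    by (intro Liminf_mono always_eventually allI dyadic_L4_bound[OF N \<sigma> b F])
  finally show ?thesis by (simp add: Liminf_const)
qed

subsection \<open>Functions of rapid decay and Fourier inversion\<close>

text \<open>The part of the Schwartz condition that is needed of a transform: decay without
  derivatives. It is stable under finite linear combinations and controls every polynomial
  modulation weight.\<close>

definition rapid :: "(real \<Rightarrow> complex) \<Rightarrow> bool" where
  "rapid F \<longleftrightarrow> F \<in> borel_measurable borel \<and> (\<forall>j. \<exists>B. \<forall>t. \<bar>t\<bar> ^ j * cmod (F t) \<le> B)"

lemma integrable_inverse_square: "integrable lborel (\<lambda>t::real. inverse (1 + t\<^sup>2))"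
  using integrable_inverse_1_plus_square by (simp add: set_integrable_def einterval_eq_UNIV)

lemma rapid_measurable: "rapid F \<Longrightarrow> F \<in> borel_measurable borel"
  by (simp add: rapid_def)

lemma rapid_bounded: "rapid F \<Longrightarrow> \<exists>B. \<forall>t. cmod (F t) \<le> B"
  unfolding rapid_def by (metis mult_1 power_0)

lemma rapid_cmult:
  assumes "rapid F" shows "rapid (\<lambda>t. c * F t)"
  unfolding rapid_def
proof (intro conjI allI)
  show "(\<lambda>t. c * F t) \<in> borel_measurable borel" using assms by (auto simp: rapid_def)
  fix j
  obtain B where B: "\<And>t. \<bar>t\<bar> ^ j * cmod (F t) \<le> B" using assms by (auto simp: rapid_def)
  have "\<bar>t\<bar> ^ j * cmod (c * F t) \<le> cmod c * B" for t
    using mult_left_mono[OF B[of t], of "cmod c"] by (simp add: norm_mult mult_ac)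
  then show "\<exists>B. \<forall>t. \<bar>t\<bar> ^ j * cmod (c * F t) \<le> B" by blast
qed

lemma rapid_add:
  assumes "rapid F" "rapid G" shows "rapid (\<lambda>t. F t + G t)"
  unfolding rapid_def
proof (intro conjI allI)
  show "(\<lambda>t. F t + G t) \<in> borel_measurable borel" using assms by (auto simp: rapid_def)
  fix j
  obtain B where B: "\<And>t. \<bar>t\<bar> ^ j * cmod (F t) \<le> B" using assms unfolding rapid_def by blast
  obtain C where C: "\<And>t. \<bar>t\<bar> ^ j * cmod (G t) \<le> C" using assms unfolding rapid_def by blast
  have "\<bar>t\<bar> ^ j * cmod (F t + G t) \<le> B + C" for t
    using mult_left_mono[OF norm_triangle_ineq[of "F t" "G t"], of "\<bar>t\<bar> ^ j"] B[of t] C[of t]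
    by (simp add: distrib_left)
  then show "\<exists>B. \<forall>t. \<bar>t\<bar> ^ j * cmod (F t + G t) \<le> B" by blast
qed

lemma rapid_zero: "rapid (\<lambda>_. 0)"
  by (auto simp: rapid_def)

lemma rapid_sum:
  "(\<And>i. i \<in> A \<Longrightarrow> rapid (F i)) \<Longrightarrow> rapid (\<lambda>t. \<Sum>i\<in>A. F i t)"
  by (induction A rule: infinite_finite_induct) (auto simp: rapid_zero intro: rapid_add)

lemma rapid_integrable:
  assumes "rapid F" shows "integrable lborel F"
proof -
  obtain B where B: "\<And>t. \<bar>t\<bar> ^ 0 * cmod (F t) \<le> B" using assms unfolding rapid_def by blast
  obtain C where C: "\<And>t. \<bar>t\<bar> ^ 2 * cmod (F t) \<le> C" using assms unfolding rapid_def by blast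
  show ?thesis
  proof (rule Bochner_Integration.integrable_bound)
    show "integrable lborel (\<lambda>t. (B + C) * inverse (1 + t\<^sup>2))"
      by (intro integrable_mult_right integrable_inverse_square)
    show "AE t in lborel. norm (F t) \<le> norm ((B + C) * inverse (1 + t\<^sup>2))"
    proof (rule AE_I2)
      fix t :: real
      have "0 < 1 + t\<^sup>2" by (simp add: add_pos_nonneg)
      moreover have "(1 + t\<^sup>2) * cmod (F t) \<le> B + C"
        using B[of t] C[of t] by (simp add: distrib_right)
      ultimately have "cmod (F t) \<le> (B + C) * inverse (1 + t\<^sup>2)"
        by (simp add: field_simps)
      then show "norm (F t) \<le> norm ((B + C) * inverse (1 + t\<^sup>2))" by simp
    qed
  qed (use assms in \<open>auto simp: rapid_def\<close>)
qed

text \<open>One factor \<open>cmod (F \<tau>)\<close> absorbs the weight, which grows at most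
  polynomially, and the other supplies integrability.\<close>

lemma rapid_weighted:
  assumes F: "rapid F"
  shows "integrable lborel (\<lambda>\<tau>. bracket (\<tau> - a) powr s * (cmod (F \<tau>))\<^sup>2)"
proof -
  have [measurable]: "F \<in> borel_measurable borel" using F by (rule rapid_measurable)
  obtain p :: nat where p: "s \<le> real p" using real_arch_simple by blast
  obtain B where B: "\<And>t. \<bar>t\<bar> ^ 0 * cmod (F t) \<le> B" using F unfolding rapid_def by blast
  obtain C where C: "\<And>t. \<bar>t\<bar> ^ p * cmod (F t) \<le> C" using F unfolding rapid_def by blast
  define K where "K = (1 + \<bar>a\<bar>) ^ p * (2 ^ p * (B + C))"
  have pt: "bracket (\<tau> - a) powr s * cmod (F \<tau>) \<le> K" for \<tau>
  proof -
    have "bracket (\<tau> - a) \<le> 1 + \<bar>\<tau> - a\<bar>"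
      unfolding bracket_def by (rule real_le_lsqrt) (auto simp: power2_eq_square algebra_simps)
    also have "\<dots> \<le> (1 + \<bar>a\<bar>) * (1 + \<bar>\<tau>\<bar>)"
      by (simp add: algebra_simps) (smt (verit) mult_nonneg_nonneg abs_ge_zero)
    finally have br: "bracket (\<tau> - a) \<le> (1 + \<bar>a\<bar>) * (1 + \<bar>\<tau>\<bar>)" .
    have "bracket (\<tau> - a) powr s \<le> bracket (\<tau> - a) powr real p"
      using p bracket_ge(1) by (intro powr_mono) auto
    also have "\<dots> = bracket (\<tau> - a) ^ p"
      using bracket_ge(1)[of "\<tau> - a"] by (intro powr_realpow) auto
    also have "\<dots> \<le> ((1 + \<bar>a\<bar>) * (1 + \<bar>\<tau>\<bar>)) ^ p"
      using bracket_ge(1)[of "\<tau> - a"] by (intro power_mono br) auto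
    also have "\<dots> = (1 + \<bar>a\<bar>) ^ p * (1 + \<bar>\<tau>\<bar>) ^ p" by (rule power_mult_distrib)
    finally have 1: "bracket (\<tau> - a) powr s \<le> (1 + \<bar>a\<bar>) ^ p * (1 + \<bar>\<tau>\<bar>) ^ p" .
    have "(1 + \<bar>\<tau>\<bar>) ^ p \<le> 2 ^ p * (1 + \<bar>\<tau>\<bar> ^ p)"
    proof (cases "\<bar>\<tau>\<bar> \<le> 1")
      case True
      then have "(1 + \<bar>\<tau>\<bar>) ^ p \<le> 2 ^ p" by (intro power_mono) auto
      also have "(2::real) ^ p \<le> 2 ^ p * (1 + \<bar>\<tau>\<bar> ^ p)" by (simp add: mult_le_cancel_left1)
      finally show ?thesis .
    next
      case False
      then have "(1 + \<bar>\<tau>\<bar>) ^ p \<le> (2 * \<bar>\<tau>\<bar>) ^ p" by (intro power_mono) auto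
      also have "\<dots> \<le> 2 ^ p * (1 + \<bar>\<tau>\<bar> ^ p)" by (simp add: power_mult_distrib)
      finally show ?thesis .
    qed
    then have "(1 + \<bar>\<tau>\<bar>) ^ p * cmod (F \<tau>) \<le> 2 ^ p * (1 + \<bar>\<tau>\<bar> ^ p) * cmod (F \<tau>)"
      by (rule mult_right_mono) simp
    also have "\<dots> = 2 ^ p * (\<bar>\<tau>\<bar> ^ 0 * cmod (F \<tau>) + \<bar>\<tau>\<bar> ^ p * cmod (F \<tau>))" by (simp add: algebra_simps)
    also have "\<dots> \<le> 2 ^ p * (B + C)" by (intro mult_left_mono add_mono B C) auto
    finally have "(1 + \<bar>a\<bar>) ^ p * ((1 + \<bar>\<tau>\<bar>) ^ p * cmod (F \<tau>)) \<le> K"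
      unfolding K_def by (intro mult_left_mono) auto
    with mult_right_mono[OF 1, of "cmod (F \<tau>)"] show ?thesis by (simp add: mult.assoc)
  qed
  show ?thesis
  proof (rule Bochner_Integration.integrable_bound)
    show "integrable lborel (\<lambda>\<tau>. K * cmod (F \<tau>))"
      using rapid_integrable[OF F] by simp
    show "AE \<tau> in lborel. norm (bracket (\<tau> - a) powr s * (cmod (F \<tau>))\<^sup>2) \<le> norm (K * cmod (F \<tau>))"
    proof (rule AE_I2)
      fix \<tau>
      have "bracket (\<tau> - a) powr s * (cmod (F \<tau>))\<^sup>2 \<le> K * cmod (F \<tau>)"
        using mult_right_mono[OF pt[of \<tau>], of "cmod (F \<tau>)"] by (simp add: power2_eq_square mult.assoc)
      then show "norm (bracket (\<tau> - a) powr s * (cmod (F \<tau>))\<^sup>2) \<le> norm (K * cmod (F \<tau>))"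
        by simp
    qed
  qed measurable
qed

lemma rapid_weighted_family:
  "(\<And>k. k \<in> grid_freqs N \<Longrightarrow> rapid (F k)) \<Longrightarrow> weighted_family N \<sigma> b F"
  unfolding weighted_family_def using rapid_integrable rapid_bounded rapid_weighted by blast

lemma integral_derivative_eq_0:
  fixes f f' :: "real \<Rightarrow> complex"
  assumes "\<And>t. (f has_vector_derivative f' t) (at t)" "\<And>t. isCont f' t" "integrable lborel f'"
    and "(f \<longlongrightarrow> 0) at_top" "(f \<longlongrightarrow> 0) at_bot"
  shows "(LINT t|lborel. f' t) = 0"
proof -
  have "(LBINT t=-\<infinity>..\<infinity>. f' t) = 0 - 0"
  proof (rule interval_integral_FTC_integrable)
    show "set_integrable lborel (einterval (-\<infinity>) \<infinity>) f'"
      using assms(3) by (simp add: set_integrable_def)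
    show "((f \<circ> real_of_ereal) \<longlongrightarrow> 0) (at_right (-\<infinity>))" "((f \<circ> real_of_ereal) \<longlongrightarrow> 0) (at_left \<infinity>)"
      using assms(4,5) by (simp_all add: ereal_tendsto_simps1)
  qed (use assms in auto)
  then show ?thesis by (simp add: interval_integral_to_infinity_eq interval_lebesgue_integral_def set_lebesgue_integral_def)
qed

lemma rapid_tendsto_0:
  assumes "rapid F" shows "(F \<longlongrightarrow> 0) at_top" "(F \<longlongrightarrow> 0) at_bot"
proof -
  obtain B where B: "\<And>t. \<bar>t\<bar> ^ 1 * cmod (F t) \<le> B" using assms unfolding rapid_def by blast
  have le: "cmod (F t) \<le> B / \<bar>t\<bar>" if "t \<noteq> 0" for t
    using B[of t] that by (simp add: field_simps)
  have "((\<lambda>t::real. B / \<bar>t\<bar>) \<longlongrightarrow> 0) at_top" "((\<lambda>t::real. B / \<bar>t\<bar>) \<longlongrightarrow> 0) at_bot"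
    by (auto intro!: tendsto_divide_0[OF tendsto_const] filterlim_at_top_imp_at_infinity filterlim_abs_real
        filterlim_compose[OF filterlim_abs_real] simp: filterlim_at_bot_mirror filterlim_ident)
  moreover have "\<forall>\<^sub>F t in at_top. norm (F t) \<le> B / \<bar>t\<bar>"
    using eventually_gt_at_top[of 0] by eventually_elim (rule le, simp)
  moreover have "\<forall>\<^sub>F t in at_bot. norm (F t) \<le> B / \<bar>t\<bar>"
    using eventually_gt_at_bot[of 0] by eventually_elim (rule le, simp)
  ultimately show "(F \<longlongrightarrow> 0) at_top" "(F \<longlongrightarrow> 0) at_bot"
    by (auto intro: Lim_null_comparison)
qed

text \<open>Integration by parts: the derivative of \<open>cis (\<tau> * t) * g t\<close> has
  integral 0, since rapid decay removes the boundary terms.\<close>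

lemma ift_derivative:
  assumes deriv: "\<And>t. (g has_vector_derivative g' t) (at t)" and cont: "\<And>t. isCont g' t"
    and g: "rapid g" and g': "rapid g'"
  shows "ift g' \<tau> = - (\<i> * \<tau>) * ift g \<tau>"
proof -
  have cis_deriv: "((\<lambda>t. cis (\<tau> * t)) has_vector_derivative \<i> * \<tau> * cis (\<tau> * t)) (at t)" for t
  proof -
    have "((\<lambda>z. exp (\<i> * \<tau> * z)) has_field_derivative \<i> * \<tau> * exp (\<i> * \<tau> * t)) (at (complex_of_real t))"
      by (auto intro!: derivative_eq_intros)
    from has_vector_derivative_real_field[OF this] show ?thesis
      by (simp add: cis_conv_exp mult.assoc)
  qed
  let ?f' = "\<lambda>t. cis (\<tau> * t) * g' t + \<i> * \<tau> * (cis (\<tau> * t) * g t)"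
  have contg: "isCont g t" for t
    using deriv has_vector_derivative_continuous by blast
  have cont_cis: "isCont (\<lambda>t. cis (\<tau> * t)) t" for t
    using cis_deriv has_vector_derivative_continuous by blast
  have int: "integrable lborel (\<lambda>t. cis (\<tau> * t) * g' t)" "integrable lborel (\<lambda>t. cis (\<tau> * t) * g t)"
    using rapid_integrable[OF g] rapid_integrable[OF g'] by (auto intro!: integrable_cis_mult)
  have lim: "((\<lambda>t. cis (\<tau> * t) * g t) \<longlongrightarrow> 0) F" if "(g \<longlongrightarrow> 0) F" for F
    by (rule tendsto_norm_zero_cancel) (use tendsto_norm_zero[OF that] in \<open>simp add: norm_mult\<close>)
  have "(LINT t|lborel. ?f' t) = 0"
  proof (rule integral_derivative_eq_0)
    show "((\<lambda>t. cis (\<tau> * t) * g t) has_vector_derivative ?f' t) (at t)" for t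
      using has_vector_derivative_mult[OF cis_deriv[of t] deriv[of t]] by (simp only: mult.assoc)
    show "isCont ?f' t" for t
      by (intro continuous_intros cont_cis cont contg)
    show "integrable lborel ?f'"
      using int by simp
  qed (use rapid_tendsto_0[OF g] lim in auto)
  also have "(LINT t|lborel. ?f' t) = ift g' \<tau> + \<i> * \<tau> * ift g \<tau>"
    unfolding ift_def using int by (subst Bochner_Integration.integral_add) auto
  finally show ?thesis by (simp add: add_eq_0_iff)
qed

lemma cmod_ift_le: "integrable lborel g \<Longrightarrow> cmod (ift g \<tau>) \<le> (LINT t|lborel. cmod (g t))"
  unfolding ift_def
  by (rule Bochner_Integration.integral_norm_bound_integral) (auto simp: norm_mult intro: integrable_cis_mult)

lemma schwartz_rapid: "schwartz g \<Longrightarrow> rapid g"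
  unfolding schwartz_def rapid_def
  by (metis borel_measurable_continuous_onI continuous_at_imp_continuous_on has_vector_derivative_continuous)

lemma schwartz_continuous: "schwartz g \<Longrightarrow> isCont g t"
  unfolding schwartz_def by (metis has_vector_derivative_continuous)

text \<open>Powers of \<tau> are traded for derivatives of \<open>g\<close>, whose transforms are
  bounded by their L^1 norms. The reflection matches the sign in \<open>st_fourier\<close>, opposite
  to that of \<open>ift\<close>.\<close>

lemma schwartz_ift_rapid:
  assumes "schwartz g" shows "rapid (\<lambda>\<tau>. ift g (- \<tau>))"
  unfolding rapid_def
proof (intro conjI allI)
  obtain D where D0: "D 0 = g" and D: "\<And>m t. (D m has_vector_derivative D (Suc m) t) (at t)"
    and bd: "\<And>j m. \<exists>B. \<forall>t. \<bar>t\<bar> ^ j * cmod (D m t) \<le> B"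
    using assms unfolding schwartz_def by blast
  \<comment> \<open>The sequence of derivatives shifted by \<open>m\<close> witnesses that each
    derivative is again Schwartz.\<close>
  have sch: "schwartz (D m)" for m
    unfolding schwartz_def using D bd by (intro exI[of _ "\<lambda>i. D (i + m)"]) auto
  have step: "ift (D (Suc m)) \<tau> = - (\<i> * \<tau>) * ift (D m) \<tau>" for m \<tau>
    by (intro ift_derivative D schwartz_continuous schwartz_rapid sch)
  have "\<bar>\<tau>\<bar> ^ m * cmod (ift g \<tau>) = cmod (ift (D m) \<tau>)" for m \<tau>
    by (induction m) (simp_all add: step norm_mult D0 mult.assoc)
  moreover have "cmod (ift (D m) \<tau>) \<le> (LINT t|lborel. cmod (D m t))" for m \<tau>
    by (intro cmod_ift_le rapid_integrable schwartz_rapid sch)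
  ultimately have le: "\<bar>\<tau>\<bar> ^ m * cmod (ift g \<tau>) \<le> (LINT t|lborel. cmod (D m t))" for m \<tau>
    by simp
  show "\<exists>B. \<forall>\<tau>. \<bar>\<tau>\<bar> ^ j * cmod (ift g (- \<tau>)) \<le> B" for j
    using le[where m = j] by (metis abs_minus_cancel)
  have "ift g \<in> borel_measurable borel"
    using schwartz_rapid[OF assms] by (intro ift_borel_measurable rapid_measurable)
  then show "(\<lambda>\<tau>. ift g (- \<tau>)) \<in> borel_measurable borel" by measurable
qed

lemma schwartz_diff:
  assumes "schwartz f" "schwartz g" shows "schwartz (\<lambda>t. f t - g t)"
proof -
  obtain D where D: "D 0 = f" "\<And>m t. (D m has_vector_derivative D (Suc m) t) (at t)"
    "\<And>j m. \<exists>B. \<forall>t. \<bar>t\<bar> ^ j * cmod (D m t) \<le> B"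
    using assms(1) unfolding schwartz_def by blast
  obtain E where E: "E 0 = g" "\<And>m t. (E m has_vector_derivative E (Suc m) t) (at t)"
    "\<And>j m. \<exists>B. \<forall>t. \<bar>t\<bar> ^ j * cmod (E m t) \<le> B"
    using assms(2) unfolding schwartz_def by blast
  have "\<exists>B. \<forall>t. \<bar>t\<bar> ^ j * cmod (D m t - E m t) \<le> B" for j m
  proof -
    obtain B where B: "\<And>t. \<bar>t\<bar> ^ j * cmod (D m t) \<le> B" using D(3) by blast
    obtain C where C: "\<And>t. \<bar>t\<bar> ^ j * cmod (E m t) \<le> C" using E(3) by blast
    have "\<bar>t\<bar> ^ j * cmod (D m t - E m t) \<le> B + C" for t
      using mult_left_mono[OF norm_triangle_ineq4[of "D m t" "E m t"], of "\<bar>t\<bar> ^ j"] B[of t] C[of t]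
      by (simp add: distrib_left)
    then show ?thesis by blast
  qed
  then show ?thesis
    unfolding schwartz_def using D(1,2) E(1,2)
    by (intro exI[of _ "\<lambda>m t. D m t - E m t"]) (auto intro: has_vector_derivative_diff)
qed

text \<open>Fubini turns the left side into the convolution of \<open>g\<close> with a normal
  density of width \<open>e\<close>. The substitution \<open>s = t + e * y\<close> moves
  \<open>e\<close> into the argument of \<open>g\<close> and fixes the measure, which prepares
  dominated convergence.\<close>

lemma gauss_regularised_inversion:
  fixes g :: "real \<Rightarrow> complex"
  assumes g: "integrable lborel g" and e: "e > 0"
  shows "(LINT \<tau>|lborel. cis (t * \<tau>) * ift g (- \<tau>) * gauss e \<tau>) =
    2 * pi * (LINT y|lborel. g (t + e * y) * std_normal_density y)"
proof -
  have [measurable]: "g \<in> borel_measurable borel" using g by auto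
  let ?f = "\<lambda>s \<tau>. cis (\<tau> * (t - s)) * (g s * gauss e \<tau>)"
  have "integrable (lborel \<Otimes>\<^sub>M lborel) (\<lambda>(s, \<tau>). g s * complex_of_real (gauss e \<tau>))"
    using integrable_gauss[OF e] by (intro integrable_pair_mult g) simp
  then have int: "integrable (lborel \<Otimes>\<^sub>M lborel) (\<lambda>(s, \<tau>). ?f s \<tau>)"
    unfolding case_prod_beta by (rule integrable_cis_mult) measurable
  have "(LINT \<tau>|lborel. cis (t * \<tau>) * ift g (- \<tau>) * gauss e \<tau>) = (LINT \<tau>|lborel. LINT s|lborel. ?f s \<tau>)"
  proof (rule Bochner_Integration.integral_cong[OF refl])
    fix \<tau> :: real
    have "cis (t * \<tau>) * ift g (- \<tau>) * gauss e \<tau> = (cis (t * \<tau>) * gauss e \<tau>) * ift g (- \<tau>)" by simp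
    also have "\<dots> = (LINT s|lborel. (cis (t * \<tau>) * gauss e \<tau>) * (cis (- \<tau> * s) * g s))"
      unfolding ift_def by (rule integral_mult_right_zero[symmetric])
    also have "\<dots> = (LINT s|lborel. ?f s \<tau>)"
    proof (rule Bochner_Integration.integral_cong[OF refl])
      fix s :: real
      have "cis (\<tau> * (t - s)) = cis (t * \<tau>) * cis (- \<tau> * s)" by (simp add: cis_mult algebra_simps)
      then show "(cis (t * \<tau>) * gauss e \<tau>) * (cis (- \<tau> * s) * g s) = ?f s \<tau>" by simp
    qed
    finally show "cis (t * \<tau>) * ift g (- \<tau>) * gauss e \<tau> = (LINT s|lborel. ?f s \<tau>)" .
  qed
  also have "\<dots> = (LINT s|lborel. LINT \<tau>|lborel. ?f s \<tau>)"
    by (rule lborel_pair.Fubini_integral[OF int])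
  also have "\<dots> = (LINT s|lborel. g s * (2 * pi * normal_density 0 e (t - s)))"
  proof (rule Bochner_Integration.integral_cong[OF refl])
    fix s :: real
    have "(LINT \<tau>|lborel. ?f s \<tau>) = (LINT \<tau>|lborel. g s * (cis (\<tau> * (t - s)) * gauss e \<tau>))"
      by (simp add: mult_ac)
    also have "\<dots> = g s * (2 * pi * normal_density 0 e (t - s))"
      by (subst integral_mult_right_zero) (simp add: fourier_gauss[OF e])
    finally show "(LINT \<tau>|lborel. ?f s \<tau>) = g s * (2 * pi * normal_density 0 e (t - s))" .
  qed
  also have "\<dots> = e *\<^sub>R (LINT y|lborel. g (t + e * y) * (2 * pi * normal_density 0 e (t - (t + e * y))))"
    using e by (subst lborel_integral_real_affine[where c = e and t = t]) auto
  also have "\<dots> = (LINT y|lborel. e *\<^sub>R (g (t + e * y) * (2 * pi * normal_density 0 e (t - (t + e * y)))))"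
    by (rule integral_scaleR_right[symmetric])
  also have "\<dots> = (LINT y|lborel. complex_of_real (2 * pi) * (g (t + e * y) * std_normal_density y))"
  proof (rule Bochner_Integration.integral_cong[OF refl])
    fix y :: real
    have "e * normal_density 0 e (t - (t + e * y)) = std_normal_density y"
      using e by (simp add: normal_density_def real_sqrt_mult power_mult_distrib)
    then have "complex_of_real e * complex_of_real (normal_density 0 e (t - (t + e * y))) = complex_of_real (std_normal_density y)"
      by (simp flip: of_real_mult)
    then show "e *\<^sub>R (g (t + e * y) * (2 * pi * normal_density 0 e (t - (t + e * y)))) =
        complex_of_real (2 * pi) * (g (t + e * y) * std_normal_density y)"
      by (simp add: scaleR_conv_of_real mult_ac)
  qed
  also have "\<dots> = 2 * pi * (LINT y|lborel. g (t + e * y) * std_normal_density y)"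
    by (subst integral_mult_right_zero) simp
  finally show ?thesis .
qed

text \<open>Both sides of the regularised identity converge as the width tends to 0: the left is
  dominated by the transform, the right by \<open>B\<close> times the standard normal
  density.\<close>

lemma fourier_inversion:
  fixes g :: "real \<Rightarrow> complex"
  assumes g: "integrable lborel g" and cont: "\<And>t. isCont g t" and B: "\<And>t. cmod (g t) \<le> B"
    and G: "integrable lborel (\<lambda>\<tau>. ift g (- \<tau>))"
  shows "ift (\<lambda>\<tau>. ift g (- \<tau>)) t = 2 * pi * g t"
proof (rule LIMSEQ_unique)
  have [measurable]: "g \<in> borel_measurable borel" using g by auto
  note ift_borel_measurable[measurable]
  let ?e = "\<lambda>n. 1 / real (Suc n)"
  let ?I = "\<lambda>n. LINT \<tau>|lborel. cis (t * \<tau>) * ift g (- \<tau>) * gauss (?e n) \<tau>"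
  have cg: "(\<lambda>n. complex_of_real (gauss (?e n) \<tau>)) \<longlonglongrightarrow> 1" for \<tau>
    using tendsto_of_real[OF gauss_tendsto[of \<tau>]] by simp
  show "?I \<longlonglongrightarrow> ift (\<lambda>\<tau>. ift g (- \<tau>)) t"
    unfolding ift_def[of "\<lambda>\<tau>. ift g (- \<tau>)" t]
  proof (rule integral_dominated_convergence[where w = "\<lambda>\<tau>. cmod (ift g (- \<tau>))"])
    show "AE \<tau> in lborel. (\<lambda>n. cis (t * \<tau>) * ift g (- \<tau>) * gauss (?e n) \<tau>) \<longlonglongrightarrow> cis (t * \<tau>) * ift g (- \<tau>)"
      using tendsto_mult[OF tendsto_const cg] by simp
    show "AE \<tau> in lborel. norm (cis (t * \<tau>) * ift g (- \<tau>) * gauss (?e n) \<tau>) \<le> cmod (ift g (- \<tau>))" for n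
      using gauss_bounds[of "?e n"] by (auto simp: norm_mult abs_of_pos intro!: mult_left_le)
  qed (use G in \<open>auto simp del: of_nat_Suc\<close>)
  have "(\<lambda>n. LINT y|lborel. g (t + ?e n * y) * std_normal_density y) \<longlonglongrightarrow> (LINT y|lborel. g t * std_normal_density y)"
  proof (rule integral_dominated_convergence[where w = "\<lambda>y. B * std_normal_density y"])
    show "AE y in lborel. (\<lambda>n. g (t + ?e n * y) * std_normal_density y) \<longlonglongrightarrow> g t * std_normal_density y"
    proof (intro AE_I2 tendsto_mult tendsto_const)
      fix y :: real
      have "(\<lambda>n. t + ?e n * y) \<longlonglongrightarrow> t + 0 * y"
        by (intro tendsto_intros LIMSEQ_Suc[OF lim_1_over_n])
      then show "(\<lambda>n. g (t + ?e n * y)) \<longlonglongrightarrow> g t"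
        using isCont_tendsto_compose[OF cont[of t]] by simp
    qed
    show "AE y in lborel. norm (g (t + ?e n * y) * std_normal_density y) \<le> B * std_normal_density y" for n
      using B by (auto simp: norm_mult intro!: mult_right_mono)
  qed auto
  then have "(\<lambda>n. 2 * pi * (LINT y|lborel. g (t + ?e n * y) * std_normal_density y)) \<longlonglongrightarrow>
      2 * pi * (LINT y|lborel. g t * std_normal_density y)"
    by (intro tendsto_mult tendsto_const)
  moreover have "(LINT y|lborel. g t * std_normal_density y) = g t"
  proof -
    have "(LINT y|lborel. g t * std_normal_density y) = g t * (LINT y|lborel. complex_of_real (std_normal_density y))"
      by (rule integral_mult_right_zero)
    also have "(LINT y|lborel. complex_of_real (std_normal_density y)) = 1"
      by (simp only: integral_complex_of_real) simp
    finally show ?thesis by simp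
  qed
  ultimately show "?I \<longlonglongrightarrow> 2 * pi * g t"
    by (simp add: gauss_regularised_inversion[OF g] del: of_nat_Suc)
qed

subsection \<open>The estimate for the completion\<close>

lemma exp_minus_i_eq_cis: "exp (- \<i> * complex_of_real a) = cis (- a)"
  by (simp add: cis_conv_exp)

lemma st_fourier_eq_ift:
  "st_fourier N f \<tau> k = complex_of_real (mesh N / (2 * pi)) *
     (\<Sum>x\<in>torus_grid N. cis (- (x * real_of_int k)) * ift (\<lambda>t. f t x) (- \<tau>))"
proof -
  have "(LINT t|lborel. exp (- \<i> * complex_of_real (t * \<tau>)) * exp (- \<i> * complex_of_real (x * real_of_int k)) * f t x) =
      cis (- (x * real_of_int k)) * ift (\<lambda>t. f t x) (- \<tau>)" for x
    unfolding exp_minus_i_eq_cis ift_def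
    by (subst integral_mult_right_zero[symmetric]) (simp add: mult_ac)
  then show ?thesis by (simp add: st_fourier_def)
qed

lemma st_fourier_rapid:
  assumes "schwartz_in_time N f" shows "rapid (\<lambda>\<tau>. st_fourier N f \<tau> k)"
  unfolding st_fourier_eq_ift
  by (intro rapid_cmult rapid_sum schwartz_ift_rapid) (use assms in \<open>auto simp: schwartz_in_time_def\<close>)

lemma bracket_nonzero [simp]: "bracket a \<noteq> 0"
  using bracket_ge(1)[of a] by linarith

lemma X_pre_norm_eq: "X_pre_norm N \<sigma> 0 b f = sqrt (weighted_energy N \<sigma> b (\<lambda>k \<tau>. st_fourier N f \<tau> k))"
  by (simp add: X_pre_norm_def weighted_energy_def)

text \<open>Inversion in time cancels the 1/(2 pi) in \<open>st_fourier\<close>; orthogonality over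
  the 2N frequencies selects one grid point with weight h * 2N = 2 pi. That is the factor by which
  \<open>synth\<close> overshoots.\<close>

lemma synth_st_fourier:
  fixes f :: "real \<Rightarrow> real \<Rightarrow> complex"
  assumes N: "N > 0" and f: "schwartz_in_time N f" and x: "x \<in> torus_grid N"
  shows "synth N (\<lambda>k \<tau>. st_fourier N f \<tau> k) t x = 2 * pi * f t x"
proof -
  let ?g = "\<lambda>x t. f t x" and ?c = "complex_of_real (mesh N / (2 * pi))"
  have sch: "schwartz (?g y)" if "y \<in> torus_grid N" for y
    using f that by (auto simp: schwartz_in_time_def)
  have inv: "ift (\<lambda>\<tau>. ift (?g y) (- \<tau>)) t = 2 * pi * f t y" if y: "y \<in> torus_grid N" for y
  proof -
    obtain B where "\<And>t. cmod (f t y) \<le> B"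
      using rapid_bounded[OF schwartz_rapid[OF sch[OF y]]] by blast
    then show ?thesis
      using sch[OF y]
      by (intro fourier_inversion rapid_integrable schwartz_rapid schwartz_ift_rapid schwartz_continuous)
  qed
  have F: "ift (\<lambda>\<tau>. st_fourier N f \<tau> k) t = complex_of_real (mesh N) * (\<Sum>y\<in>torus_grid N. cis (- (y * real_of_int k)) * f t y)" for k
  proof -
    have "ift (\<lambda>\<tau>. st_fourier N f \<tau> k) t =
        ift (\<lambda>\<tau>. \<Sum>y\<in>torus_grid N. ?c * cis (- (y * real_of_int k)) * ift (?g y) (- \<tau>)) t"
      unfolding st_fourier_eq_ift sum_distrib_left by (simp add: mult.assoc)
    also have "\<dots> = (\<Sum>y\<in>torus_grid N. ift (\<lambda>\<tau>. ?c * cis (- (y * real_of_int k)) * ift (?g y) (- \<tau>)) t)"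
      by (intro ift_sum rapid_integrable rapid_cmult schwartz_ift_rapid sch)
    also have "\<dots> = (\<Sum>y\<in>torus_grid N. ?c * cis (- (y * real_of_int k)) * ift (\<lambda>\<tau>. ift (?g y) (- \<tau>)) t)"
    proof (rule sum.cong[OF refl])
      fix y
      show "ift (\<lambda>\<tau>. ?c * cis (- (y * real_of_int k)) * ift (?g y) (- \<tau>)) t =
          ?c * cis (- (y * real_of_int k)) * ift (\<lambda>\<tau>. ift (?g y) (- \<tau>)) t"
        unfolding ift_def[of "\<lambda>\<tau>. ift (?g y) (- \<tau>)"] ift_def[of "\<lambda>\<tau>. ?c * cis (- (y * real_of_int k)) * ift (?g y) (- \<tau>)"]
        by (subst integral_mult_right_zero[symmetric]) (simp add: mult_ac)
    qed
    also have "\<dots> = complex_of_real (mesh N) * (\<Sum>y\<in>torus_grid N. cis (- (y * real_of_int k)) * f t y)"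
      unfolding sum_distrib_left by (intro sum.cong refl) (simp add: inv)
    finally show ?thesis .
  qed
  obtain n where n: "n \<in> {- int N..<int N}" and xn: "x = mesh N * real_of_int n"
    using x by (auto simp: torus_grid_def)
  have "synth N (\<lambda>k \<tau>. st_fourier N f \<tau> k) t x =
      (\<Sum>k\<in>grid_freqs N. \<Sum>y\<in>torus_grid N. complex_of_real (mesh N) * f t y * cis (x * real_of_int k - y * real_of_int k))"
    unfolding synth_def F sum_distrib_left
    by (intro sum.cong refl) (simp add: diff_conv_add_uminus cis_mult[symmetric] mult_ac del: add_uminus_conv_diff)
  also have "\<dots> = (\<Sum>y\<in>torus_grid N. complex_of_real (mesh N) * f t y * (\<Sum>k\<in>grid_freqs N. cis (x * real_of_int k - y * real_of_int k)))"
    unfolding sum_distrib_left by (rule sum.swap)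
  also have "\<dots> = (\<Sum>m\<in>{- int N..<int N}. complex_of_real (mesh N) * f t (mesh N * real_of_int m) *
      (if m = n then of_nat (2 * N) else 0))"
    unfolding sum_torus_grid[OF N]
  proof (intro sum.cong refl arg_cong2[where f = "(*)"])
    fix m assume m: "m \<in> {- int N..<int N}"
    have "(\<Sum>k\<in>grid_freqs N. cis (x * real_of_int k - mesh N * real_of_int m * real_of_int k)) =
        (\<Sum>k\<in>{- int N..<int N}. cis (mesh N * real_of_int k * real_of_int (n - m)))"
      unfolding grid_freqs_def xn by (intro sum.cong refl) (simp add: algebra_simps)
    also have "\<dots> = (if 2 * int N dvd n - m then of_nat (2 * N) else 0)"
      by (rule sum_roots_of_unity[OF N])
    \<comment> \<open>Both indices lie in one block of 2N integers, so their difference is smaller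
      than 2N in modulus.\<close>
    also have "2 * int N dvd n - m \<longleftrightarrow> m = n"
      using m n zdvd_imp_le[of "2 * int N" "n - m"] zdvd_imp_le[of "2 * int N" "m - n"]
      by (cases "m < n"; cases "n < m") (auto simp: dvd_diff_commute)
    finally show "(\<Sum>k\<in>grid_freqs N. cis (x * real_of_int k - mesh N * real_of_int m * real_of_int k)) =
        (if m = n then of_nat (2 * N) else 0)" .
  qed
  also have "\<dots> = (\<Sum>m\<in>{- int N..<int N}. if m = n then complex_of_real (mesh N) * f t (mesh N * real_of_int m) * of_nat (2 * N) else 0)"
    by (intro sum.cong refl) auto
  also have "\<dots> = complex_of_real (mesh N) * f t x * of_nat (2 * N)"
    using n by (simp add: xn)
  also have "\<dots> = complex_of_real (2 * (mesh N * real N)) * f t x" by simp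
  finally show ?thesis by (simp add: mesh_mult[OF N])
qed

lemma schwartz_L4_bound:
  assumes N: "N > 0" and \<sigma>: "\<sigma> \<in> {1, - 1}" and b: "b > 1 / 3" and f: "schwartz_in_time N f"
  shows "(\<integral>\<^sup>+t. ennreal (L4_slice N (f t)) \<partial>lborel) \<le> ennreal (L4_const b * X_pre_norm N \<sigma> 0 b f ^ 4)"
proof -
  let ?F = "\<lambda>k \<tau>. st_fourier N f \<tau> k"
  have F: "weighted_family N \<sigma> b ?F"
    by (intro rapid_weighted_family st_fourier_rapid f)
  have "L4_slice N (f t) \<le> L4_slice N (synth N ?F t)" for t
    \<comment> \<open>The factor \<open>2 * pi\<close> between \<open>synth\<close> and
      \<open>f\<close> exceeds 1 and is simply discarded.\<close>
    unfolding L4_slice_def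
  proof (intro mult_left_mono sum_mono power_mono)
    fix x assume "x \<in> torus_grid N"
    then have "cmod (synth N ?F t x) = 2 * pi * cmod (f t x)"
      by (simp add: synth_st_fourier[OF N f] norm_mult)
    then show "cmod (f t x) \<le> cmod (synth N ?F t x)"
      using pi_ge_two by (simp add: mult_le_cancel_right1)
  qed (use mesh_pos[OF N] in auto)
  then have "(\<integral>\<^sup>+t. ennreal (L4_slice N (f t)) \<partial>lborel) \<le> (\<integral>\<^sup>+t. ennreal (L4_slice N (synth N ?F t)) \<partial>lborel)"
    by (intro nn_integral_mono ennreal_leI)
  also have "\<dots> \<le> ennreal (L4_const b * (weighted_energy N \<sigma> b ?F)\<^sup>2)"
    by (rule synth_L4_bound[OF N \<sigma> b F])
  also have "(weighted_energy N \<sigma> b ?F)\<^sup>2 = X_pre_norm N \<sigma> 0 b f ^ 4"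
    unfolding X_pre_norm_eq power4_eq_xxxx by (simp add: weighted_energy_nonneg power2_eq_square mult.assoc)
  finally show ?thesis .
qed

lemma X_pre_norm_nonneg: "0 \<le> X_pre_norm N \<sigma> 0 b f"
  by (simp add: X_pre_norm_eq weighted_energy_nonneg)

text \<open>A stand-in for the triangle inequality. The factors 2 are harmless, as only boundedness
  along Cauchy sequences is drawn from it.\<close>

lemma X_pre_norm_square_add_le:
  assumes f: "schwartz_in_time N f" and g: "schwartz_in_time N g"
  shows "(X_pre_norm N \<sigma> 0 b f)\<^sup>2 \<le>
    2 * (X_pre_norm N \<sigma> 0 b (\<lambda>t x. f t x - g t x))\<^sup>2 + 2 * (X_pre_norm N \<sigma> 0 b g)\<^sup>2"
proof -
  let ?d = "\<lambda>t x. f t x - g t x"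
  let ?w = "\<lambda>k \<tau>. bracket (\<tau> - \<sigma> * dispersion N k) powr (2 * b)"
  have d: "schwartz_in_time N ?d"
    using f g by (auto simp: schwartz_in_time_def intro: schwartz_diff)
  have sum: "st_fourier N f \<tau> k = st_fourier N ?d \<tau> k + st_fourier N g \<tau> k" for \<tau> k
  proof -
    have "ift (\<lambda>t. f t x) (- \<tau>) = ift (\<lambda>t. ?d t x) (- \<tau>) + ift (\<lambda>t. g t x) (- \<tau>)" if "x \<in> torus_grid N" for x
    proof -
      have "integrable lborel (\<lambda>t. ?d t x)" "integrable lborel (\<lambda>t. g t x)"
        using d g that by (auto simp: schwartz_in_time_def intro: rapid_integrable schwartz_rapid)
      note this[THEN integrable_cis_mult, of "\<lambda>t. - \<tau> * t"]
      then have "integrable lborel (\<lambda>t. cis (- \<tau> * t) * ?d t x)" "integrable lborel (\<lambda>t. cis (- \<tau> * t) * g t x)"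
        by simp_all
      from Bochner_Integration.integral_add[OF this] show ?thesis
        by (simp add: ift_def right_diff_distrib)
    qed
    then show ?thesis
      by (simp add: st_fourier_eq_ift distrib_left sum.distrib)
  qed
  have int: "integrable lborel (\<lambda>\<tau>. ?w k \<tau> * (cmod (st_fourier N h \<tau> k))\<^sup>2)" if "schwartz_in_time N h" for h k
    by (intro rapid_weighted st_fourier_rapid that)
  have "weighted_energy N \<sigma> b (\<lambda>k \<tau>. st_fourier N f \<tau> k) \<le>
      (\<Sum>k\<in>grid_freqs N. 2 * (LINT \<tau>|lborel. ?w k \<tau> * (cmod (st_fourier N ?d \<tau> k))\<^sup>2) +
        2 * (LINT \<tau>|lborel. ?w k \<tau> * (cmod (st_fourier N g \<tau> k))\<^sup>2))"
    unfolding weighted_energy_def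
  proof (rule sum_mono)
    fix k
    have "(LINT \<tau>|lborel. ?w k \<tau> * (cmod (st_fourier N f \<tau> k))\<^sup>2) \<le>
        (LINT \<tau>|lborel. 2 * (?w k \<tau> * (cmod (st_fourier N ?d \<tau> k))\<^sup>2) + 2 * (?w k \<tau> * (cmod (st_fourier N g \<tau> k))\<^sup>2))"
    proof (rule integral_mono)
      fix \<tau> :: real
      let ?a = "cmod (st_fourier N ?d \<tau> k)" and ?b = "cmod (st_fourier N g \<tau> k)"
      have "(cmod (st_fourier N f \<tau> k))\<^sup>2 \<le> (?a + ?b)\<^sup>2"
        unfolding sum[of \<tau> k] by (intro power_mono norm_triangle_ineq) auto
      also have "\<dots> \<le> 2 * ?a\<^sup>2 + 2 * ?b\<^sup>2"
        using sum_squares_bound[of ?a ?b] by (simp add: power2_sum)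
      finally have "?w k \<tau> * (cmod (st_fourier N f \<tau> k))\<^sup>2 \<le> ?w k \<tau> * (2 * ?a\<^sup>2 + 2 * ?b\<^sup>2)"
        by (rule mult_left_mono) simp
      then show "?w k \<tau> * (cmod (st_fourier N f \<tau> k))\<^sup>2 \<le> 2 * (?w k \<tau> * ?a\<^sup>2) + 2 * (?w k \<tau> * ?b\<^sup>2)"
        by (simp add: algebra_simps)
    qed (use int[OF f] int[OF d] int[OF g] in auto)
    also have "\<dots> = 2 * (LINT \<tau>|lborel. ?w k \<tau> * (cmod (st_fourier N ?d \<tau> k))\<^sup>2) +
        2 * (LINT \<tau>|lborel. ?w k \<tau> * (cmod (st_fourier N g \<tau> k))\<^sup>2)"
      using int[OF d] int[OF g] by (subst Bochner_Integration.integral_add) auto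
    finally show "(LINT \<tau>|lborel. ?w k \<tau> * (cmod (st_fourier N f \<tau> k))\<^sup>2) \<le> \<dots>" .
  qed
  also have "\<dots> = 2 * weighted_energy N \<sigma> b (\<lambda>k \<tau>. st_fourier N ?d \<tau> k) + 2 * weighted_energy N \<sigma> b (\<lambda>k \<tau>. st_fourier N g \<tau> k)"
    by (simp add: weighted_energy_def sum.distrib sum_distrib_left)
  finally show ?thesis
    by (simp add: X_pre_norm_eq weighted_energy_nonneg)
qed

lemma X_represents_subseq:
  assumes \<phi>: "X_represents N \<sigma> s b \<phi> f" and r: "strict_mono r"
  shows "X_represents N \<sigma> s b (\<phi> \<circ> r) f"
  unfolding X_represents_def
proof (intro conjI allI impI)
  show "schwartz_in_time N ((\<phi> \<circ> r) n)" for n using \<phi> by (simp add: X_represents_def)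
  show "f \<in> LtLx_space N 2 2" using \<phi> by (simp add: X_represents_def)
  have "(\<lambda>n. LtLx_norm N 2 2 (\<lambda>t x. \<phi> n t x - f t x)) \<longlonglongrightarrow> 0" using \<phi> by (simp add: X_represents_def)
  from LIMSEQ_subseq_LIMSEQ[OF this r]
  show "(\<lambda>n. LtLx_norm N 2 2 (\<lambda>t x. (\<phi> \<circ> r) n t x - f t x)) \<longlonglongrightarrow> 0" by (simp add: o_def)
  fix e :: real assume "e > 0"
  then obtain M where "\<And>m n. m \<ge> M \<Longrightarrow> n \<ge> M \<Longrightarrow> X_pre_norm N \<sigma> s b (\<lambda>t x. \<phi> m t x - \<phi> n t x) < e"
    using \<phi> unfolding X_represents_def by blast
  then show "\<exists>M. \<forall>m\<ge>M. \<forall>n\<ge>M. X_pre_norm N \<sigma> s b (\<lambda>t x. (\<phi> \<circ> r) m t x - (\<phi> \<circ> r) n t x) < e"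
    using seq_suble[OF r] by (intro exI[of _ M]) (auto intro: order_trans)
qed

text \<open>Boundedness suffices: a subsequence along which the norms converge represents the same
  function, so the choice in \<open>X_norm\<close> is not vacuous.\<close>

lemma X_norm_attained:
  assumes "f \<in> X_space N \<sigma> 0 b"
  shows "\<exists>\<phi>. X_represents N \<sigma> 0 b \<phi> f \<and> (\<lambda>n. X_pre_norm N \<sigma> 0 b (\<phi> n)) \<longlonglongrightarrow> X_norm N \<sigma> 0 b f"
proof -
  obtain \<phi> where \<phi>: "X_represents N \<sigma> 0 b \<phi> f" using assms by (auto simp: X_space_def)
  let ?p = "\<lambda>n. X_pre_norm N \<sigma> 0 b (\<phi> n)"
  have sch: "schwartz_in_time N (\<phi> n)" for n using \<phi> by (simp add: X_represents_def)
  obtain M where M: "\<And>m n. m \<ge> M \<Longrightarrow> n \<ge> M \<Longrightarrow> X_pre_norm N \<sigma> 0 b (\<lambda>t x. \<phi> m t x - \<phi> n t x) < 1"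
    using \<phi> zero_less_one unfolding X_represents_def by blast
  \<comment> \<open>Each later member differs from member \<open>M\<close> by less than 1 in the
    norm, so its squared norm is at most 2 * 1 plus twice that of member \<open>M\<close>.\<close>
  define K where "K = sqrt (2 + 2 * (?p M)\<^sup>2)"
  have bound: "?p (n + M) \<in> {0..K}" for n
  proof -
    have "(X_pre_norm N \<sigma> 0 b (\<lambda>t x. \<phi> (n + M) t x - \<phi> M t x))\<^sup>2 \<le> 1"
      using M[of "n + M" M] by (intro power_le_one X_pre_norm_nonneg) auto
    then have "(?p (n + M))\<^sup>2 \<le> 2 + 2 * (?p M)\<^sup>2"
      using X_pre_norm_square_add_le[OF sch[of "n + M"] sch[of M], of \<sigma> b] by linarith
    then show ?thesis
      using X_pre_norm_nonneg by (simp add: K_def real_le_rsqrt)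
  qed
  have "seq_compact {0..K}" by (simp add: compact_imp_seq_compact)
  then obtain l r where r: "strict_mono (r :: nat \<Rightarrow> nat)" and l: "((\<lambda>n. ?p (n + M)) \<circ> r) \<longlonglongrightarrow> l"
    using bound unfolding seq_compact_def by metis
  have rM: "strict_mono (\<lambda>n. r n + M)" using r by (simp add: strict_mono_def)
  have "\<exists>r \<phi>. X_represents N \<sigma> 0 b \<phi> f \<and> (\<lambda>n. X_pre_norm N \<sigma> 0 b (\<phi> n)) \<longlonglongrightarrow> r"
    using X_represents_subseq[OF \<phi> rM] l by (auto simp: o_def)
  then show ?thesis unfolding X_norm_def by (rule someI_ex)
qed

section \<open>Slice norms and almost everywhere convergence of representing sequences\<close>

lemma Lp_grid_norm_4: "Lp_grid_norm N 4 g powr 4 = L4_slice N g"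
proof -
  have "cmod z powr 4 = cmod z ^ 4" for z by (simp add: powr_numeral)
  then have "Lp_grid_norm N 4 g = L4_slice N g powr (1 / 4)"
    by (simp add: Lp_grid_norm_def L4_slice_def)
  then show ?thesis by (simp add: powr_powr L4_slice_nonneg)
qed

definition L2_slice :: "nat \<Rightarrow> (real \<Rightarrow> complex) \<Rightarrow> real" where
  "L2_slice N g = mesh N * (\<Sum>x\<in>torus_grid N. (cmod (g x))\<^sup>2)"

lemma L2_slice_nonneg: "0 \<le> L2_slice N g"
  by (simp add: L2_slice_def mesh_def sum_nonneg)

lemma Lp_grid_norm_2: "Lp_grid_norm N 2 g powr 2 = L2_slice N g"
proof -
  have "cmod z powr 2 = (cmod z)\<^sup>2" for z by (simp add: powr_numeral)
  then have "Lp_grid_norm N 2 g = L2_slice N g powr (1 / 2)"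
    by (simp add: Lp_grid_norm_def L2_slice_def)
  then show ?thesis by (simp add: powr_powr L2_slice_nonneg)
qed

lemma L2_slice_measurable:
  assumes [measurable]: "\<And>x. x \<in> torus_grid N \<Longrightarrow> (\<lambda>t. g t x) \<in> borel_measurable M"
  shows "(\<lambda>t. L2_slice N (g t)) \<in> borel_measurable M"
  unfolding L2_slice_def by measurable

lemma L2_slice_diff_le: "L2_slice N (\<lambda>x. g x - h x) \<le> 2 * L2_slice N g + 2 * L2_slice N h"
proof -
  have "(cmod (g x - h x))\<^sup>2 \<le> 2 * (cmod (g x))\<^sup>2 + 2 * (cmod (h x))\<^sup>2" for x
  proof -
    have "(cmod (g x - h x))\<^sup>2 \<le> (cmod (g x) + cmod (h x))\<^sup>2"
      by (intro power_mono norm_triangle_ineq4) auto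
    then show ?thesis
      using sum_squares_bound[of "cmod (g x)" "cmod (h x)"] by (simp add: power2_sum)
  qed
  then have "L2_slice N (\<lambda>x. g x - h x) \<le> mesh N * (\<Sum>x\<in>torus_grid N. 2 * (cmod (g x))\<^sup>2 + 2 * (cmod (h x))\<^sup>2)"
    unfolding L2_slice_def by (intro mult_left_mono sum_mono) (auto simp: mesh_def)
  also have "\<dots> = 2 * L2_slice N g + 2 * L2_slice N h"
    by (simp add: L2_slice_def sum.distrib sum_distrib_left algebra_simps)
  finally show ?thesis .
qed

lemma schwartz_L2_slice_integrable:
  assumes "schwartz_in_time N f" shows "integrable lborel (\<lambda>t. L2_slice N (f t))"
proof -
  have "integrable lborel (\<lambda>t. (cmod (f t x))\<^sup>2)" if "x \<in> torus_grid N" for x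
    using rapid_weighted[OF schwartz_rapid, of "\<lambda>t. f t x" 0 0] assms that
    by (simp add: schwartz_in_time_def)
  then show ?thesis
    unfolding L2_slice_def by (intro integrable_mult_right Bochner_Integration.integrable_sum)
qed

text \<open>Convergence in L^2 means that the squared slice norms tend to 0 in L^1 of time, hence
  almost everywhere along a subsequence. A slice norm controls every grid point, so one null set of
  times serves all of them.\<close>

lemma representing_AE_subseq:
  assumes N: "N > 0" and \<phi>: "X_represents N \<sigma> s b \<phi> f"
  shows "\<exists>r. strict_mono r \<and> (AE t in lborel. \<forall>x\<in>torus_grid N. (\<lambda>n. \<phi> (r n) t x) \<longlonglongrightarrow> f t x)"
proof -
  let ?v = "\<lambda>n t. L2_slice N (\<lambda>x. \<phi> n t x - f t x)"
  have f: "f \<in> LtLx_space N 2 2" and sch: "schwartz_in_time N (\<phi> n)" for n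
    using \<phi> by (auto simp: X_represents_def)
  have [measurable]: "(\<lambda>t. f t x) \<in> borel_measurable borel" if "x \<in> torus_grid N" for x
    using f that by (simp add: LtLx_space_def)
  have [measurable]: "(\<lambda>t. \<phi> n t x) \<in> borel_measurable borel" if "x \<in> torus_grid N" for x n
    using sch that by (auto simp: schwartz_in_time_def intro: rapid_measurable schwartz_rapid)
  have f_int: "integrable lborel (\<lambda>t. L2_slice N (f t))"
    using f by (simp add: LtLx_space_def Lp_grid_norm_2)
  have int: "integrable lborel (?v n)" for n
  proof (rule Bochner_Integration.integrable_bound)
    show "integrable lborel (\<lambda>t. 2 * L2_slice N (\<phi> n t) + 2 * L2_slice N (f t))"
      using f_int schwartz_L2_slice_integrable[OF sch] by simp
    show "?v n \<in> borel_measurable lborel"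
      by (intro L2_slice_measurable) simp
    show "AE t in lborel. norm (?v n t) \<le> norm (2 * L2_slice N (\<phi> n t) + 2 * L2_slice N (f t))"
      using L2_slice_diff_le[of N "\<phi> n t" "f t" for t] L2_slice_nonneg by (auto simp: abs_of_nonneg)
  qed
  have "(\<lambda>n. (LtLx_norm N 2 2 (\<lambda>t x. \<phi> n t x - f t x))\<^sup>2) \<longlonglongrightarrow> 0\<^sup>2"
    using \<phi> unfolding X_represents_def by (intro tendsto_power) auto
  moreover have "(LtLx_norm N 2 2 (\<lambda>t x. \<phi> n t x - f t x))\<^sup>2 = (LINT t|lborel. norm (?v n t))" for n
  proof -
    have nn: "0 \<le> (LINT t|lborel. ?v n t)" by (intro Bochner_Integration.integral_nonneg) (simp add: L2_slice_nonneg)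
    show ?thesis
      using nn by (simp add: LtLx_norm_def Lp_grid_norm_2 L2_slice_nonneg powr_half_sqrt)
  qed
  ultimately have "(\<lambda>n. LINT t|lborel. norm (?v n t)) \<longlonglongrightarrow> 0" by simp
  from tendsto_L1_AE_subseq[OF int this] obtain r :: "nat \<Rightarrow> nat" where r: "strict_mono r"
    and ae: "AE t in lborel. (\<lambda>n. ?v (r n) t) \<longlonglongrightarrow> 0" by blast
  have "AE t in lborel. \<forall>x\<in>torus_grid N. (\<lambda>n. \<phi> (r n) t x) \<longlonglongrightarrow> f t x"
    using ae
  proof eventually_elim
    fix t assume lim: "(\<lambda>n. ?v (r n) t) \<longlonglongrightarrow> 0"
    show "\<forall>x\<in>torus_grid N. (\<lambda>n. \<phi> (r n) t x) \<longlonglongrightarrow> f t x"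
    proof
      fix x assume x: "x \<in> torus_grid N"
      have le: "cmod (\<phi> (r n) t x - f t x) \<le> sqrt (?v (r n) t / mesh N)" for n
      proof (rule real_le_rsqrt)
        have "(cmod (\<phi> (r n) t x - f t x))\<^sup>2 \<le> (\<Sum>x\<in>torus_grid N. (cmod (\<phi> (r n) t x - f t x))\<^sup>2)"
          using x by (intro member_le_sum) auto
        then show "(cmod (\<phi> (r n) t x - f t x))\<^sup>2 \<le> ?v (r n) t / mesh N"
          using mesh_pos[OF N] by (simp add: L2_slice_def)
      qed
      have "(\<lambda>n. sqrt (?v (r n) t / mesh N)) \<longlonglongrightarrow> sqrt (0 / mesh N)"
        using mesh_pos[OF N] by (intro tendsto_intros lim) auto
      then have "(\<lambda>n. \<phi> (r n) t x - f t x) \<longlonglongrightarrow> 0"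
        by (intro Lim_null_comparison[OF always_eventually[OF allI[OF le]]]) simp
      then show "(\<lambda>n. \<phi> (r n) t x) \<longlonglongrightarrow> f t x" by (rule LIM_zero_cancel)
    qed
  qed
  with r show ?thesis by blast
qed

text \<open>Fatou along an almost everywhere convergent subsequence of a sequence attaining
  \<open>X_norm\<close>; passing to the subsequence keeps the limit of the norms. The argument works
  for whichever value the choice operator picks.\<close>

lemma X_L4_bound:
  assumes N: "N > 0" and \<sigma>: "\<sigma> \<in> {1, - 1}" and b: "b > 1 / 3" and f: "f \<in> X_space N \<sigma> 0 b"
  shows "f \<in> LtLx_space N 4 4" "LtLx_norm N 4 4 f \<le> L4_const b powr (1 / 4) * X_norm N \<sigma> 0 b f"
proof -
  let ?X = "X_norm N \<sigma> 0 b f"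
  obtain \<phi> where \<phi>: "X_represents N \<sigma> 0 b \<phi> f" and lim: "(\<lambda>n. X_pre_norm N \<sigma> 0 b (\<phi> n)) \<longlonglongrightarrow> ?X"
    using X_norm_attained[OF f] by blast
  obtain r where r: "strict_mono r" and ae: "AE t in lborel. \<forall>x\<in>torus_grid N. (\<lambda>n. \<phi> (r n) t x) \<longlonglongrightarrow> f t x"
    using representing_AE_subseq[OF N \<phi>] by blast
  have X0: "0 \<le> ?X"
    by (rule LIMSEQ_le_const[OF lim]) (simp add: X_pre_norm_nonneg)
  have sch: "schwartz_in_time N (\<phi> n)" for n using \<phi> by (simp add: X_represents_def)
  have fm [measurable]: "(\<lambda>t. f t x) \<in> borel_measurable borel" if "x \<in> torus_grid N" for x
    using \<phi> that by (simp add: X_represents_def LtLx_space_def)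
  have \<phi>m [measurable]: "(\<lambda>t. \<phi> n t x) \<in> borel_measurable borel" if "x \<in> torus_grid N" for x n
    using sch that by (auto simp: schwartz_in_time_def intro: rapid_measurable schwartz_rapid)
  have m: "(\<lambda>t. L4_slice N (\<phi> n t)) \<in> borel_measurable borel" "(\<lambda>t. L4_slice N (f t)) \<in> borel_measurable borel" for n
    by (auto intro!: L4_slice_measurable \<phi>m fm)
  have "(\<integral>\<^sup>+t. ennreal (L4_slice N (f t)) \<partial>lborel) = (\<integral>\<^sup>+t. liminf (\<lambda>n. ennreal (L4_slice N (\<phi> (r n) t))) \<partial>lborel)"
  proof (rule nn_integral_cong_AE)
    show "AE t in lborel. ennreal (L4_slice N (f t)) = liminf (\<lambda>n. ennreal (L4_slice N (\<phi> (r n) t)))"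
      using ae
    proof eventually_elim
      fix t assume "\<forall>x\<in>torus_grid N. (\<lambda>n. \<phi> (r n) t x) \<longlonglongrightarrow> f t x"
      then have "(\<lambda>n. ennreal (L4_slice N (\<phi> (r n) t))) \<longlonglongrightarrow> ennreal (L4_slice N (f t))"
        by (intro tendsto_ennrealI L4_slice_tendsto) auto
      then show "ennreal (L4_slice N (f t)) = liminf (\<lambda>n. ennreal (L4_slice N (\<phi> (r n) t)))"
        by (intro lim_imp_Liminf[symmetric]) auto
    qed
  qed
  also have "\<dots> \<le> liminf (\<lambda>n. \<integral>\<^sup>+t. ennreal (L4_slice N (\<phi> (r n) t)) \<partial>lborel)"
    using m by (intro nn_integral_liminf) auto
  also have "\<dots> \<le> liminf (\<lambda>n. ennreal (L4_const b * X_pre_norm N \<sigma> 0 b (\<phi> (r n)) ^ 4))"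
    by (intro Liminf_mono always_eventually allI schwartz_L4_bound[OF N \<sigma> b sch])
  also have "\<dots> = ennreal (L4_const b * ?X ^ 4)"
  proof (rule lim_imp_Liminf)
    have "(\<lambda>n. X_pre_norm N \<sigma> 0 b (\<phi> (r n))) \<longlonglongrightarrow> ?X"
      using LIMSEQ_subseq_LIMSEQ[OF lim r] by (simp add: o_def)
    then show "(\<lambda>n. ennreal (L4_const b * X_pre_norm N \<sigma> 0 b (\<phi> (r n)) ^ 4)) \<longlonglongrightarrow> ennreal (L4_const b * ?X ^ 4)"
      by (intro tendsto_ennrealI tendsto_intros)
  qed simp
  finally have le: "(\<integral>\<^sup>+t. ennreal (L4_slice N (f t)) \<partial>lborel) \<le> ennreal (L4_const b * ?X ^ 4)" .
  \<comment> \<open>Finiteness of the nonnegative integral yields integrability, hence membership in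
    the space, before the Lebesgue integral is evaluated.\<close>
  have int: "integrable lborel (\<lambda>t. L4_slice N (f t))"
    using m(2) le by (intro integrableI_bounded) (auto simp: L4_slice_nonneg intro: le_less_trans)
  then show "f \<in> LtLx_space N 4 4"
    using fm by (simp add: LtLx_space_def Lp_grid_norm_4)
  have c: "0 \<le> L4_const b * ?X ^ 4" using L4_const_pos[OF b] X0 by simp
  have "ennreal (LINT t|lborel. L4_slice N (f t)) \<le> ennreal (L4_const b * ?X ^ 4)"
    using le by (subst nn_integral_eq_integral[OF int, symmetric]) (auto simp: L4_slice_nonneg)
  then have "(LINT t|lborel. L4_slice N (f t)) \<le> L4_const b * ?X ^ 4"
    using c by simp
  then have "LtLx_norm N 4 4 f \<le> (L4_const b * ?X ^ 4) powr (1 / 4)"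
    unfolding LtLx_norm_def Lp_grid_norm_4
    by (intro powr_mono2) (auto simp: L4_slice_nonneg intro: Bochner_Integration.integral_nonneg)
  also have "\<dots> = L4_const b powr (1 / 4) * (?X ^ 4) powr (1 / 4)"
    by (rule powr_mult)
  also have "(?X ^ 4) powr (1 / 4) = ?X"
  proof -
    have X4: "?X ^ 4 = ?X powr 4" using X0 by (simp add: powr_numeral)
    show ?thesis unfolding X4 powr_powr using X0 by simp
  qed
  finally show "LtLx_norm N 4 4 f \<le> L4_const b powr (1 / 4) * ?X" .
qed

text \<open>Membership in \<open>LtLx_space N 4 4\<close> is asserted together with the inequality
  because the integral in \<open>LtLx_norm\<close> would be 0 by default for a nonintegrable
  function. The constant depends on \<open>b\<close> alone.\<close>

theorem proposition4p5:
  fixes b :: real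
  assumes "b > 1 / 3"
  shows "\<exists>C>0. \<forall>(N::nat) (\<sigma>::real) f.
           0 < mesh N \<longrightarrow> mesh N \<le> 1 \<longrightarrow> \<sigma> \<in> {1, - 1} \<longrightarrow> f \<in> X_space N \<sigma> 0 b \<longrightarrow>
           f \<in> LtLx_space N 4 4 \<and> LtLx_norm N 4 4 f \<le> C * X_norm N \<sigma> 0 b f"
proof (intro exI[of _ "L4_const b powr (1 / 4)"] conjI allI impI)
  show "0 < L4_const b powr (1 / 4)" using L4_const_pos[OF assms] by simp
  fix N :: nat and \<sigma> :: real and f
  assume "0 < mesh N" "\<sigma> \<in> {1, - 1}" "f \<in> X_space N \<sigma> 0 b"
  \<comment> \<open>For \<open>N = 0\<close> division by zero gives mesh 0, so a positive mesh
    excludes this case.\<close>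
  moreover from this have "N > 0" by (cases N) (auto simp: mesh_def)
  ultimately show "f \<in> LtLx_space N 4 4" "LtLx_norm N 4 4 f \<le> L4_const b powr (1 / 4) * X_norm N \<sigma> 0 b f"
    using X_L4_bound assms by blast+
qed

end
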